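(* Let $\mathrm{M}$ be a matroid on a finite ground set $E$ with $|E|=n$, let $\mathrm{N}$ be a matroid on a finite ground set $F$, and let $f:\mathrm{M}\to\mathrm{N}$ be a morphism of matroids. Let $\mathrm{b}_k(f)$ be the number of bases of $f$ of cardinality $k$. Then for all integers $k$ with $0<k<n$, $$\frac{\mathrm{b}_k(f)^2}{\binom{n}{k}^2}\ \ge\ \frac{\mathrm{b}_{k-1}(f)}{\binom{n}{k-1}}\cdot\frac{\mathrm{b}_{k+1}(f)}{\binom{n}{k+1}}.$$
   Context: A matroid $\mathrm{M}$ on a finite set $E$ is given by its rank function $\operatorname{rk}_{\mathrm{M}}:2^E\to\mathbb{N}$ (with $\operatorname{rk}_{\mathrm M}(S)\le|S|$, monotone, submodular). A basis of $\mathrm{M}$ is a subset $S$ with $\operatorname{rk}_{\mathrm M}(S)=|S|=\operatorname{rk}_{\mathrm M}(E)$. A morphism $f:\mathrm{M}\to\mathrm{N}$ between matroids $\mathrm{M}$ on $E$ and $\mathrm{N}$ on $F$ is a function $f:E\to F$ such that $\operatorname{rk}_{\mathrm{N}}(f(S_2))-\operatorname{rk}_{\mathrm{N}}(f(S_1))\le\operatorname{rk}_{\mathrm{M}}(S_2)-\operatorname{rk}_{\mathrm{M}}(S_1)$ for all $S_1\subseteq S_2\subseteq E$. A subset $S\subseteq E$ is a basis of $f$ if $S$ is contained in a basis of $\mathrm{M}$ and $f(S)$ contains a basis of $\mathrm{N}$. *)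

theory Defs
  imports Complex_Main
begin

text \<open>
  A matroid is given by a finite ground set and its rank function.  The rank function is a total
  function on sets; only its values on subsets of the ground set matter.
\<close>

locale matroid =
  fixes E :: "'a set" and rk :: "'a set \<Rightarrow> nat"
  assumes finite_ground: "finite E"
    and rk_le_card: "S \<subseteq> E \<Longrightarrow> rk S \<le> card S"
    and rk_mono: "S \<subseteq> T \<Longrightarrow> T \<subseteq> E \<Longrightarrow> rk S \<le> rk T"
    and rk_submodular:
      "S \<subseteq> E \<Longrightarrow> T \<subseteq> E \<Longrightarrow> rk (S \<union> T) + rk (S \<inter> T) \<le> rk S + rk T"

definition matroid_basis :: "'a set \<Rightarrow> ('a set \<Rightarrow> nat) \<Rightarrow> 'a set \<Rightarrow> bool" where
  "matroid_basis E rk S \<longleftrightarrow> S \<subseteq> E \<and> rk S = card S \<and> card S = rk E"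

text \<open>Rank differences are taken in the integers, to avoid truncated subtraction.\<close>

locale matroid_morphism = M: matroid E rkM + N: matroid F rkN
  for E :: "'a set" and rkM :: "'a set \<Rightarrow> nat"
    and F :: "'b set" and rkN :: "'b set \<Rightarrow> nat" +
  fixes f :: "'a \<Rightarrow> 'b"
  assumes maps_to: "f ` E \<subseteq> F"
    and rk_diff_le:
      "S1 \<subseteq> S2 \<Longrightarrow> S2 \<subseteq> E \<Longrightarrow>
        int (rkN (f ` S2)) - int (rkN (f ` S1)) \<le> int (rkM S2) - int (rkM S1)"

definition morphism_basis ::
  "'a set \<Rightarrow> ('a set \<Rightarrow> nat) \<Rightarrow> 'b set \<Rightarrow> ('b set \<Rightarrow> nat) \<Rightarrow> ('a \<Rightarrow> 'b) \<Rightarrow> 'a set \<Rightarrow> bool" where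
  "morphism_basis E rkM F rkN f S \<longleftrightarrow>
     S \<subseteq> E \<and> (\<exists>B. matroid_basis E rkM B \<and> S \<subseteq> B) \<and> (\<exists>B. matroid_basis F rkN B \<and> B \<subseteq> f ` S)"

definition num_morphism_bases ::
  "'a set \<Rightarrow> ('a set \<Rightarrow> nat) \<Rightarrow> 'b set \<Rightarrow> ('b set \<Rightarrow> nat) \<Rightarrow> ('a \<Rightarrow> 'b) \<Rightarrow> nat \<Rightarrow> nat" where
  "num_morphism_bases E rkM F rkN f k = card {S. morphism_basis E rkM F rkN f S \<and> card S = k}"

end

theory Submission
  imports Defs "HOL-Library.Multiset" "HOL-Analysis.Convex"
begin

text \<open>
  Let \<open>n = |E|\<close>.  Pulling the rank function of \<open>N\<close> back along \<open>f\<close> gives a second matroid \<open>g\<close> on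
  \<open>E\<close>, and the morphism condition says that \<open>g\<close> is a quotient of \<open>M\<close>.  If \<open>f(E)\<close> spans \<open>N\<close>, the
  bases of \<open>f\<close> are exactly the sets that are independent in \<open>M\<close> and spanning in \<open>g\<close>
  (\<open>morphism_basis_iff\<close>); otherwise there are none and the inequality is \<open>0 \<ge> 0\<close>.

  Consider the homogeneous polynomial
  \<open>h = \<Sum>\<^sub>S w\<^sub>0 ^ (n - |S|) * \<Prod>\<^bsub>i\<in>S\<^esub> w\<^sub>i\<close>, summed over the bases \<open>S\<close> of \<open>f\<close>.  Differentiating it
  \<open>n - k - 1\<close> times with respect to \<open>w\<^sub>0\<close> and \<open>k - 1\<close> times in the direction \<open>\<Sum>\<^sub>i \<partial>\<^sub>i\<close> leaves a
  quadratic form.  Its values on the direction of \<open>w\<^sub>0\<close> and on the direction \<open>(0, 1, \<dots>, 1)\<close> are, up to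
  factorials, the numbers \<open>b\<^bsub>k-1\<^esub>\<close>, \<open>b\<^sub>k\<close> and \<open>b\<^bsub>k+1\<^esub>\<close>, and the theorem is the reverse
  Cauchy-Schwarz inequality for these two vectors.  So it suffices that the form is hyperbolic,
  i.e. has at most one positive direction.  In other words, \<open>h\<close> is a Lorentzian polynomial, and the
  proof is a self-contained version of that fact for \<open>h\<close>.

  Hyperbolicity is proved by induction on the number of directional derivatives
  (\<open>hyperbolic_hessian_dirderiv\<close>).  For a form \<open>Q\<close> obtained by differentiating along \<open>u\<close>, Euler's
  formula writes \<open>Q\<close> as a combination of the forms \<open>Q\<^sup>r\<close> with one derivative along \<open>u\<close> replaced by
  \<open>\<partial>\<^sub>r\<close>, and the rows of \<open>Q\<close> are \<open>Q\<^sup>r(\<cdot>, u)\<close>.  Reverse Cauchy-Schwarz for the \<open>Q\<^sup>r\<close> then says, after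
  normalising \<open>Q\<close> to a matrix \<open>K\<close> that is self-adjoint for a suitable inner product and fixes \<open>u\<close>,
  that \<open>K \<le> K\<^sup>2\<close>, while the Perron-Frobenius argument gives \<open>K \<le> 1\<close>, with \<open>1\<close> a simple eigenvalue
  if the graph of positive entries is connected.  Hence no eigenvalue lies strictly between \<open>0\<close> and
  \<open>1\<close>, and only one is positive (\<open>hyperbolic_of_row_bound\<close>).

  Two matroid facts feed this induction.  When only partial derivatives are taken, the quadratic
  forms are explicit.  Their essential part is a sum over non-parallel pairs in the contraction
  by a set \<open>A\<close>, a square minus
  the squares of the sums over the parallel classes (\<open>hyperbolic_hessian_coeff\<close>); the bound on the
  number of parallel classes by \<open>n - |A|\<close> is what makes the binomial normalisation come out.
  Connectivity of the supports follows from augmentation and exchange of bases of \<open>f\<close>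
  (\<open>connected_support_hessian_dirderiv\<close>).  The Perron-Frobenius step needs a strictly positive
  direction \<open>u\<close>, so \<open>w\<^sub>0\<close> is given the weight \<open>\<epsilon> > 0\<close>, and \<open>\<epsilon>\<close> tends to \<open>0\<close> at the end
  (\<open>ultra_log_concave_bases\<close>).
\<close>

section \<open>Hyperbolic quadratic forms\<close>

definition bform :: "'i set \<Rightarrow> ('i \<Rightarrow> 'i \<Rightarrow> real) \<Rightarrow> ('i \<Rightarrow> real) \<Rightarrow> ('i \<Rightarrow> real) \<Rightarrow> real" where
  "bform I M v w = (\<Sum>i\<in>I. \<Sum>j\<in>I. M i j * v i * w j)"

text \<open>
  For a symmetric matrix this says that there is no plane on which the form is positive definite,
  that is, at most one eigenvalue is positive.
\<close>

definition hyperbolic :: "'i set \<Rightarrow> ('i \<Rightarrow> 'i \<Rightarrow> real) \<Rightarrow> bool" where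
  "hyperbolic I M \<longleftrightarrow>
    (\<forall>v w. bform I M w w > 0 \<longrightarrow> bform I M v v * bform I M w w \<le> (bform I M v w)\<^sup>2)"

lemma bform_cong:
  assumes "\<And>i j. i \<in> I \<Longrightarrow> j \<in> I \<Longrightarrow> M i j = M' i j"
    and "\<And>i. i \<in> I \<Longrightarrow> v i = v' i" and "\<And>i. i \<in> I \<Longrightarrow> w i = w' i"
  shows "bform I M v w = bform I M' v' w'"
  unfolding bform_def using assms by (intro sum.cong refl) simp

lemma bform_commute:
  assumes "\<And>i j. M i j = M j i"
  shows "bform I M v w = bform I M w v"
proof -
  have "bform I M v w = (\<Sum>j\<in>I. \<Sum>i\<in>I. M i j * v i * w j)"
    unfolding bform_def by (rule sum.swap)
  also have "\<dots> = bform I M w v"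
    unfolding bform_def using assms by (intro sum.cong refl) (simp add: mult_ac)
  finally show ?thesis .
qed

lemma bform_rows: "bform I M v w = (\<Sum>i\<in>I. v i * (\<Sum>j\<in>I. M i j * w j))"
  unfolding bform_def by (simp add: sum_distrib_left mult_ac)

lemma bform_combination:
  assumes "\<And>i j. M i j = M j i"
  shows "bform I M (\<lambda>i. b * v i - a * w i) (\<lambda>i. b * v i - a * w i) =
    b\<^sup>2 * bform I M v v - 2 * a * b * bform I M v w + a\<^sup>2 * bform I M w w"
proof -
  have "bform I M (\<lambda>i. b * v i - a * w i) (\<lambda>i. b * v i - a * w i) =
    b\<^sup>2 * bform I M v v - a * b * bform I M v w - a * b * bform I M w v + a\<^sup>2 * bform I M w w"
    unfolding bform_def sum_distrib_left sum.distrib[symmetric] sum_subtractf[symmetric]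
    by (intro sum.cong refl) (simp add: algebra_simps power2_eq_square)
  then show ?thesis
    using bform_commute[of M I w v, OF assms] by (simp add: algebra_simps)
qed

text \<open>
  A positive definite plane would meet every hyperplane in a nonzero vector.  Concretely, for
  \<open>w\<close> with \<open>M(w,w) > 0\<close>, the combination of \<open>v\<close> and \<open>w\<close> that lies in the hyperplane has nonpositive
  square, and expanding this is the claimed inequality.
\<close>

lemma hyperbolic_if_nonpos_on_hyperplane:
  assumes sym: "\<And>i j. M i j = M j i"
    and neg: "\<And>v. (\<Sum>i\<in>I. h i * v i) = 0 \<Longrightarrow> bform I M v v \<le> 0"
  shows "hyperbolic I M"
  unfolding hyperbolic_def
proof (intro allI impI)
  fix v w assume pos: "bform I M w w > 0"
  define a where "a = (\<Sum>i\<in>I. h i * v i)"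
  define b where "b = (\<Sum>i\<in>I. h i * w i)"
  define A B C where "A = bform I M v v" and "B = bform I M v w" and "C = bform I M w w"
  have "b \<noteq> 0"
    using neg[of w] pos by (auto simp: b_def)
  have "(\<Sum>i\<in>I. h i * (b * v i - a * w i)) = b * (\<Sum>i\<in>I. h i * v i) - a * (\<Sum>i\<in>I. h i * w i)"
    unfolding sum_distrib_left sum_subtractf[symmetric]
    by (intro sum.cong refl) (simp add: algebra_simps)
  also have "\<dots> = 0"
    by (simp add: a_def b_def)
  finally have "b\<^sup>2 * A - 2 * a * b * B + a\<^sup>2 * C \<le> 0"
    using neg bform_combination[of M I b v a w, OF sym] unfolding A_def B_def C_def by metis
  then have "(b\<^sup>2 * A - 2 * a * b * B + a\<^sup>2 * C) * C \<le> 0"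
    using pos by (simp add: C_def mult_nonpos_nonneg)
  then have "b\<^sup>2 * (A * C) \<le> b\<^sup>2 * B\<^sup>2 - (b * B - a * C)\<^sup>2"
    by (simp add: algebra_simps power2_eq_square)
  also have "\<dots> \<le> b\<^sup>2 * B\<^sup>2"
    by simp
  finally have "A * C \<le> B\<^sup>2"
    using \<open>b \<noteq> 0\<close> by simp
  then show "bform I M v v * bform I M w w \<le> (bform I M v w)\<^sup>2"
    by (simp add: A_def B_def C_def)
qed

text \<open>
  Gaussian elimination: the pivots of a positive definite matrix are positive, and the Schur complement
  is again positive definite.  The index set is a finite set rather than a finite type, since it will
  be built from the ground set of a matroid.
\<close>

lemma positive_definite_solvable:
  assumes "finite I" and "\<And>i j. G i j = G j i"
    and "\<And>x. \<exists>i\<in>I. x i \<noteq> 0 \<Longrightarrow> bform I G x x > 0"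
  shows "\<exists>x. \<forall>i\<in>I. (\<Sum>j\<in>I. G i j * x j) = b i"
  using assms
proof (induction I arbitrary: G b rule: finite_induct)
  case empty
  then show ?case by simp
next
  case (insert p I)
  note sym = insert.prems(1) and pd = insert.prems(2)
  have expand: "bform (insert p I) G x x =
      G p p * (x p)\<^sup>2 + 2 * x p * (\<Sum>j\<in>I. G p j * x j) + bform I G x x" for x
  proof -
    have "(\<Sum>i\<in>I. G i p * x i * x p) = x p * (\<Sum>j\<in>I. G p j * x j)"
      unfolding sum_distrib_left
      by (intro sum.cong refl) (use sym in \<open>simp add: mult_ac\<close>)
    moreover have "(\<Sum>j\<in>I. G p j * x p * x j) = x p * (\<Sum>j\<in>I. G p j * x j)"
      by (simp add: sum_distrib_left mult_ac)
    ultimately show ?thesis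
      using insert.hyps unfolding bform_def
      by (simp add: sum.distrib power2_eq_square algebra_simps)
  qed
  have pos: "G p p > 0"
  proof -
    have "bform I G (\<lambda>i. if i = p then 1 else 0) (\<lambda>i. if i = p then 1 else 0) = 0"
      unfolding bform_def using insert.hyps by (intro sum.neutral ballI) auto
    moreover have "(\<Sum>j\<in>I. G p j * (if j = p then 1 else 0)) = 0"
      using insert.hyps by (intro sum.neutral ballI) auto
    ultimately show ?thesis
      using pd[of "\<lambda>i. if i = p then 1 else 0"] expand[of "\<lambda>i. if i = p then 1 else 0"]
      by simp
  qed
  \<comment> \<open>The Schur complement of the pivot.\<close>
  define G' where "G' = (\<lambda>i j. G i j - G i p * G p j / G p p)"
  have sym': "G' i j = G' j i" for i j
    using sym by (simp add: G'_def mult_ac)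
  have pd': "bform I G' x x > 0" if nz: "\<exists>i\<in>I. x i \<noteq> 0" for x
  proof -
    define s where "s = (\<Sum>j\<in>I. G p j * x j)"
    \<comment> \<open>The value at the pivot that minimises the form for fixed other coordinates.\<close>
    define y where "y = x(p := - s / G p p)"
    have y_on: "y i = x i" if "i \<in> I" for i
      using that insert.hyps by (auto simp: y_def)
    have "\<exists>i\<in>insert p I. y i \<noteq> 0"
      using nz y_on by auto
    then have "0 < bform (insert p I) G y y"
      by (rule pd)
    also have "\<dots> = G p p * (y p)\<^sup>2 + 2 * y p * (\<Sum>j\<in>I. G p j * y j) + bform I G y y"
      by (rule expand)
    also have "(\<Sum>j\<in>I. G p j * y j) = s"
      unfolding s_def by (intro sum.cong refl) (simp add: y_on)
    also have "bform I G y y = bform I G x x"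
      by (rule bform_cong) (auto simp: y_on)
    also have "G p p * (y p)\<^sup>2 + 2 * y p * s + bform I G x x = bform I G x x - s * s / G p p"
      using pos by (simp add: y_def field_simps power2_eq_square)
    also have "s * s / G p p = (\<Sum>i\<in>I. \<Sum>j\<in>I. G i p * G p j / G p p * x i * x j)"
    proof -
      have s': "s = (\<Sum>i\<in>I. G i p * x i)"
        unfolding s_def by (intro sum.cong refl) (use sym in simp)
      have "s * s / G p p = (\<Sum>i\<in>I. G i p * x i) * (\<Sum>j\<in>I. G p j * x j) / G p p"
        using s' s_def by metis
      then show ?thesis
        unfolding sum_product by (simp add: sum_divide_distrib mult_ac)
    qed
    also have "bform I G x x - \<dots> = bform I G' x x"
      unfolding bform_def G'_def sum_subtractf[symmetric]
      by (intro sum.cong refl) (simp add: algebra_simps)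
    finally show ?thesis .
  qed
  obtain x where x: "\<forall>i\<in>I. (\<Sum>j\<in>I. G' i j * x j) = b i - G i p * b p / G p p"
    using insert.IH[of G' "\<lambda>i. b i - G i p * b p / G p p"] sym' pd' by blast
  define s where "s = (\<Sum>j\<in>I. G p j * x j)"
  define y where "y = x(p := (b p - s) / G p p)"
  have sums: "(\<Sum>j\<in>insert p I. G i j * y j) = G i p * y p + (\<Sum>j\<in>I. G i j * x j)" for i
  proof -
    have "(\<Sum>j\<in>I. G i j * y j) = (\<Sum>j\<in>I. G i j * x j)"
      using insert.hyps by (intro sum.cong refl) (auto simp: y_def)
    then show ?thesis
      using insert.hyps by simp
  qed
  have "(\<Sum>j\<in>insert p I. G i j * y j) = b i" if "i \<in> insert p I" for i
  proof (cases "i = p")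
    case True
    then show ?thesis
      using pos by (simp only: sums) (simp add: y_def s_def[symmetric])
  next
    case False
    then have "i \<in> I" using that by simp
    have "(\<Sum>j\<in>I. G' i j * x j) = (\<Sum>j\<in>I. G i j * x j) - G i p / G p p * s"
      unfolding G'_def s_def sum_distrib_left sum_subtractf[symmetric]
      by (intro sum.cong refl) (simp add: algebra_simps)
    then have "(\<Sum>j\<in>I. G i j * x j) = b i - G i p * b p / G p p + G i p / G p p * s"
      using x[rule_format, OF \<open>i \<in> I\<close>] by linarith
    then show ?thesis
      using pos by (simp only: sums) (simp add: y_def field_simps)
  qed
  then show ?case by blast
qed

section \<open>The local-to-global principle for hyperbolicity\<close>

text \<open>
  Join \<open>i\<close> and \<open>j\<close> when \<open>M i j > 0\<close>; all indices with a nonzero row lie in one component.  Components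
  are described by the functions that are constant along edges, because the Perron-Frobenius argument
  produces such a function.
\<close>

definition connected_support :: "'i set \<Rightarrow> ('i \<Rightarrow> 'i \<Rightarrow> real) \<Rightarrow> bool" where
  "connected_support I M \<longleftrightarrow>
    (\<forall>z :: 'i \<Rightarrow> real. (\<forall>i\<in>I. \<forall>j\<in>I. M i j > 0 \<longrightarrow> z i = z j) \<longrightarrow>
      (\<forall>i\<in>I. \<forall>j\<in>I. (\<exists>a\<in>I. M i a > 0) \<longrightarrow> (\<exists>b\<in>I. M j b > 0) \<longrightarrow> z i = z j))"

text \<open>
  The right-hand side is the Dirichlet form of the graph with weights \<open>M i j * u i * u j\<close>.  For
  nonnegative entries it shows that \<open>M\<close> is dominated by the diagonal form with entries \<open>(M u)\<^sub>i / u\<^sub>i\<close>, with equality only for vectors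
  proportional to \<open>u\<close> on each component.
\<close>

lemma row_norm_minus_bform:
  assumes sym: "\<And>i j. M i j = M j i" and u: "\<And>i. i \<in> I \<Longrightarrow> 0 < u i"
  shows "(\<Sum>i\<in>I. (\<Sum>j\<in>I. M i j * u j) / u i * (y i)\<^sup>2) - bform I M y y =
    (\<Sum>i\<in>I. \<Sum>j\<in>I. M i j * u i * u j * (y i / u i - y j / u j)\<^sup>2) / 2"
proof -
  define T where "T = (\<Sum>i\<in>I. \<Sum>j\<in>I. M i j * u j / u i * (y i)\<^sup>2)"
  have "T = (\<Sum>j\<in>I. \<Sum>i\<in>I. M i j * u j / u i * (y i)\<^sup>2)"
    unfolding T_def by (rule sum.swap)
  also have "\<dots> = (\<Sum>i\<in>I. \<Sum>j\<in>I. M i j * u i / u j * (y j)\<^sup>2)"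
    by (intro sum.cong refl) (use sym in simp)
  finally have T': "T = (\<Sum>i\<in>I. \<Sum>j\<in>I. M i j * u i / u j * (y j)\<^sup>2)" .
  have "(\<Sum>i\<in>I. \<Sum>j\<in>I. M i j * u i * u j * (y i / u i - y j / u j)\<^sup>2) = T + T - 2 * bform I M y y"
    apply (subst (2) T')
    unfolding T_def bform_def sum_distrib_left sum.distrib[symmetric] sum_subtractf[symmetric]
    apply (intro sum.cong refl)
    subgoal for i j
      using u[of i] u[of j] by (simp add: field_simps power2_eq_square)
    done
  moreover have "T = (\<Sum>i\<in>I. (\<Sum>j\<in>I. M i j * u j) / u i * (y i)\<^sup>2)"
    unfolding T_def by (simp add: sum_distrib_right sum_divide_distrib)
  ultimately show ?thesis by simp
qed

text \<open>
  Let \<open>d\<^sub>i = (M u)\<^sub>i / u\<^sub>i\<close>, let \<open>D\<close> be the diagonal matrix with these entries and \<open>K = D\<^sup>-\<^sup>1 M\<close>.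
  The row bound reads \<open>\<langle>K x, x\<rangle> \<le> \<langle>K x, K x\<rangle>\<close> for the inner product given by \<open>D\<close>, and
  \<open>row_norm_minus_bform\<close> gives \<open>\<langle>K y, y\<rangle> \<le> \<langle>y, y\<rangle>\<close>.  By connectivity the kernel of \<open>1 - K\<close> is spanned
  by \<open>u\<close>, so every \<open>v\<close> orthogonal to \<open>u\<close> has the form \<open>v = x - K x\<close>.  With \<open>y = K x\<close> this gives
  \<open>\<langle>K v, v\<rangle> = \<langle>K x, x\<rangle> - 2 \<langle>y, y\<rangle> + \<langle>K y, y\<rangle> \<le> 0\<close>, with no recourse to the spectral theorem.
\<close>

lemma hyperbolic_of_row_bound_positive:
  assumes fin: "finite I" and sym: "\<And>i j. M i j = M j i"
    and nonneg: "\<And>i j. i \<in> I \<Longrightarrow> j \<in> I \<Longrightarrow> 0 \<le> M i j"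
    and u: "\<And>i. i \<in> I \<Longrightarrow> 0 < u i"
    and pos: "\<And>i. i \<in> I \<Longrightarrow> 0 < (\<Sum>j\<in>I. M i j * u j)"
    and conn: "\<forall>z :: 'i \<Rightarrow> real. (\<forall>i\<in>I. \<forall>j\<in>I. M i j > 0 \<longrightarrow> z i = z j)
      \<longrightarrow> (\<forall>i\<in>I. \<forall>j\<in>I. z i = z j)"
    and rows: "\<And>v. bform I M v v \<le>
      (\<Sum>i\<in>I. u i * (\<Sum>j\<in>I. M i j * v j)\<^sup>2 / (\<Sum>j\<in>I. M i j * u j))"
  shows "hyperbolic I M"
proof (cases "I = {}")
  case True
  then show ?thesis by (simp add: hyperbolic_def bform_def)
next
  case False
  define m where "m i = (\<Sum>j\<in>I. M i j * u j)" for i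
  define d where "d i = m i / u i" for i
  have m: "0 < m i" if "i \<in> I" for i
    using pos[OF that] by (simp add: m_def)
  have d: "0 < d i" if "i \<in> I" for i
    using m[OF that] u[OF that] by (simp add: d_def)
  have gap: "(\<Sum>i\<in>I. d i * (y i)\<^sup>2) - bform I M y y =
    (\<Sum>i\<in>I. \<Sum>j\<in>I. M i j * u i * u j * (y i / u i - y j / u j)\<^sup>2) / 2" for y
    unfolding d_def m_def by (rule row_norm_minus_bform[OF sym u])
  have summand_nonneg: "0 \<le> M i j * u i * u j * (y i / u i - y j / u j)\<^sup>2"
    if "i \<in> I" "j \<in> I" for i j y
    using nonneg[OF that] u[OF that(1)] u[OF that(2)] by simp
  have contraction: "bform I M y y \<le> (\<Sum>i\<in>I. d i * (y i)\<^sup>2)" for y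
  proof -
    have "0 \<le> (\<Sum>i\<in>I. \<Sum>j\<in>I. M i j * u i * u j * (y i / u i - y j / u j)\<^sup>2)"
      by (intro sum_nonneg summand_nonneg)
    then show ?thesis using gap[of y] by simp
  qed
  \<comment> \<open>\<open>D - M\<close> is only semidefinite, with kernel spanned by \<open>u\<close>; the rank one term, the square of the
    functional \<open>x \<mapsto> M(x, u)\<close>, makes it definite.\<close>
  define G where "G i j = (if i = j then d i else 0) - M i j + m i * m j" for i j
  have G_row: "(\<Sum>j\<in>I. G i j * x j) =
      d i * x i - (\<Sum>j\<in>I. M i j * x j) + m i * (\<Sum>j\<in>I. m j * x j)" if "i \<in> I" for i x
  proof -
    have "(\<Sum>j\<in>I. G i j * x j) =
        (\<Sum>j\<in>I. (if i = j then d i * x j else 0)) - (\<Sum>j\<in>I. M i j * x j)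
        + m i * (\<Sum>j\<in>I. m j * x j)"
      unfolding G_def sum_distrib_left sum.distrib[symmetric] sum_subtractf[symmetric]
      by (intro sum.cong refl) (simp add: algebra_simps)
    then show ?thesis
      using fin that by (simp add: sum.delta')
  qed
  have G_form: "bform I G x x =
      (\<Sum>i\<in>I. d i * (x i)\<^sup>2) - bform I M x x + (\<Sum>j\<in>I. m j * x j)\<^sup>2" for x
  proof -
    have "bform I G x x = (\<Sum>i\<in>I. x i * (\<Sum>j\<in>I. G i j * x j))"
      by (rule bform_rows)
    also have "\<dots> = (\<Sum>i\<in>I. d i * (x i)\<^sup>2 - x i * (\<Sum>j\<in>I. M i j * x j)
        + (\<Sum>j\<in>I. m j * x j) * (m i * x i))"
      by (intro sum.cong refl) (simp only: G_row, simp add: algebra_simps power2_eq_square)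
    also have "\<dots> = (\<Sum>i\<in>I. d i * (x i)\<^sup>2) - bform I M x x
        + (\<Sum>j\<in>I. m j * x j) * (\<Sum>i\<in>I. m i * x i)"
      by (simp add: sum.distrib sum_subtractf bform_rows sum_distrib_left)
    finally show ?thesis by (simp add: power2_eq_square)
  qed
  have G_sym: "G i j = G j i" for i j
    using sym[of i j] by (simp add: G_def)
  have mu: "0 < (\<Sum>i\<in>I. m i * u i)"
    using fin False m u by (intro sum_pos) auto
  have G_pd: "bform I G x x > 0" if nz: "\<exists>i\<in>I. x i \<noteq> 0" for x
  proof (rule ccontr)
    assume "\<not> bform I G x x > 0"
    then have "(\<Sum>i\<in>I. d i * (x i)\<^sup>2) - bform I M x x + (\<Sum>j\<in>I. m j * x j)\<^sup>2 \<le> 0"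
      by (simp add: G_form)
    then have eq: "(\<Sum>i\<in>I. d i * (x i)\<^sup>2) - bform I M x x = 0"
      and "(\<Sum>j\<in>I. m j * x j)\<^sup>2 = 0"
      using contraction[of x] zero_le_power2[of "\<Sum>j\<in>I. m j * x j"] by linarith+
    then have orth: "(\<Sum>j\<in>I. m j * x j) = 0" by simp
    have "(\<Sum>i\<in>I. \<Sum>j\<in>I. M i j * u i * u j * (x i / u i - x j / u j)\<^sup>2) = 0"
      using gap[of x] eq by simp
    then have zero: "M i j * u i * u j * (x i / u i - x j / u j)\<^sup>2 = 0" if "i \<in> I" "j \<in> I" for i j
      using that fin summand_nonneg
      by (simp add: sum_nonneg_eq_0_iff sum_nonneg)
    have "x i / u i = x j / u j" if "i \<in> I" "j \<in> I" "M i j > 0" for i j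
      using zero[OF that(1,2)] that(3) u[OF that(1)] u[OF that(2)] by simp
    then have "\<forall>i\<in>I. \<forall>j\<in>I. M i j > 0 \<longrightarrow> x i / u i = x j / u j"
      by simp
    then have const: "\<forall>i\<in>I. \<forall>j\<in>I. x i / u i = x j / u j"
      by (rule conn[THEN spec[of _ "\<lambda>i. x i / u i"], THEN mp])
    obtain p where p: "p \<in> I" "x p \<noteq> 0" using nz by blast
    have "m j * x j = x p / u p * (m j * u j)" if "j \<in> I" for j
      using const[rule_format, OF that p(1)] u[OF that] by (simp add: field_simps)
    then have "(\<Sum>j\<in>I. m j * x j) = x p / u p * (\<Sum>j\<in>I. m j * u j)"
      by (simp add: sum_distrib_left)
    then show False
      using orth mu p u[OF p(1)] by simp
  qed
  show ?thesis
  proof (rule hyperbolic_if_nonpos_on_hyperplane[OF sym])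
    fix v assume v: "(\<Sum>i\<in>I. m i * v i) = 0"
    have "\<exists>x. \<forall>i\<in>I. (\<Sum>j\<in>I. G i j * x j) = d i * v i"
      by (rule positive_definite_solvable[OF fin G_sym G_pd])
    then obtain x where x: "\<And>i. i \<in> I \<Longrightarrow> (\<Sum>j\<in>I. G i j * x j) = d i * v i" by blast
    define l where "l = (\<Sum>j\<in>I. m j * x j)"
    have row: "d i * x i - (\<Sum>j\<in>I. M i j * x j) + m i * l = d i * v i" if "i \<in> I" for i
      using x[OF that] G_row[OF that, of x] by (simp add: l_def)
    have "bform I M u x = bform I M x u"
      by (rule bform_commute[OF sym])
    also have "\<dots> = l"
      by (simp add: bform_rows l_def m_def mult_ac)
    finally have lux: "bform I M u x = l" .
    \<comment> \<open>Pairing the equation for \<open>x\<close> with \<open>u\<close> shows that the rank one term vanishes at \<open>x\<close>, so that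
      \<open>D v = (D - M) x\<close>.\<close>
    have "(\<Sum>i\<in>I. u i * (d i * x i - (\<Sum>j\<in>I. M i j * x j) + m i * l)) =
        (\<Sum>i\<in>I. m i * x i) - bform I M u x + l * (\<Sum>i\<in>I. m i * u i)"
      unfolding bform_rows sum_distrib_left sum.distrib[symmetric] sum_subtractf[symmetric]
      apply (intro sum.cong refl)
      subgoal for i
        using u[of i] by (simp add: d_def algebra_simps sum_distrib_left)
      done
    moreover have "(\<Sum>i\<in>I. u i * (d i * x i - (\<Sum>j\<in>I. M i j * x j) + m i * l)) = (\<Sum>i\<in>I. m i * v i)"
      apply (intro sum.cong refl)
      subgoal for i
        using u[of i] row[of i] by (simp add: d_def)
      done
    ultimately have "l * (\<Sum>i\<in>I. m i * u i) = 0"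
      using v lux by (simp add: l_def)
    then have l0: "l = 0" using mu by simp
    define y where "y i = (\<Sum>j\<in>I. M i j * x j) / d i" for i
    have v_eq: "v i = x i - y i" if "i \<in> I" for i
      using row[OF that] l0 d[OF that] by (simp add: y_def field_simps)
    have Mx: "(\<Sum>j\<in>I. M i j * x j) = d i * y i" if "i \<in> I" for i
      using d[OF that] by (simp add: y_def)
    define Y where "Y = (\<Sum>i\<in>I. d i * (y i)\<^sup>2)"
    have yx: "bform I M y x = Y"
      unfolding bform_rows Y_def
      by (intro sum.cong refl) (simp add: Mx power2_eq_square)
    have "bform I M x x \<le> (\<Sum>i\<in>I. u i * (\<Sum>j\<in>I. M i j * x j)\<^sup>2 / m i)"
      unfolding m_def by (rule rows)
    also have "\<dots> = Y"
      unfolding Y_def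
      apply (intro sum.cong refl)
      subgoal for i
        using u[of i] m[of i] by (simp add: Mx) (simp add: d_def field_simps power2_eq_square)
      done
    finally have xx: "bform I M x x \<le> Y" .
    have "bform I M v v = bform I M (\<lambda>i. 1 * x i - 1 * y i) (\<lambda>i. 1 * x i - 1 * y i)"
      by (rule bform_cong) (auto simp: v_eq)
    also have "\<dots> = bform I M x x - 2 * bform I M x y + bform I M y y"
      using bform_combination[of M I 1 x 1 y, OF sym] by simp
    also have "bform I M x y = Y"
      using yx bform_commute[of M I x y, OF sym] by simp
    finally show "bform I M v v \<le> 0"
      using xx contraction[of y] by (simp add: Y_def)
  qed
qed

text \<open>
  Indices with a zero row do not contribute to the form.  In their terms of the row bound the
  denominator is \<open>0\<close>, and division by \<open>0\<close> gives \<open>0\<close>.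
\<close>

lemma hyperbolic_of_row_bound:
  fixes I :: "'i set"
  assumes fin: "finite I" and sym: "\<And>i j. M i j = M j i"
    and nonneg: "\<And>i j. i \<in> I \<Longrightarrow> j \<in> I \<Longrightarrow> 0 \<le> M i j"
    and u: "\<And>i. i \<in> I \<Longrightarrow> 0 < u i"
    and conn: "connected_support I M"
    and rows: "\<And>v. bform I M v v \<le>
      (\<Sum>i\<in>I. u i * (\<Sum>j\<in>I. M i j * v j)\<^sup>2 / (\<Sum>j\<in>I. M i j * u j))"
  shows "hyperbolic I M"
proof -
  define J where "J = {i \<in> I. \<exists>a\<in>I. M i a > 0}"
  have J: "J \<subseteq> I" "finite J" using fin by (auto simp: J_def)
  have zero: "M i j = 0" if "i \<in> I" "j \<in> I" "i \<notin> J \<or> j \<notin> J" for i j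
  proof -
    have "\<not> M i j > 0 \<or> \<not> M j i > 0"
      using that unfolding J_def by blast
    then show ?thesis
      using that nonneg[of i j] sym[of i j] by linarith
  qed
  have row_J: "(\<Sum>j\<in>I. M i j * x j) = (\<Sum>j\<in>J. M i j * x j)" if "i \<in> I" for i x
    using fin J zero[OF that] by (intro sum.mono_neutral_right) auto
  have form_J: "bform I M v w = bform J M v w" for v w
  proof -
    have "bform I M v w = (\<Sum>i\<in>I. v i * (\<Sum>j\<in>J. M i j * w j))"
      unfolding bform_rows by (intro sum.cong refl) (simp add: row_J)
    also have "\<dots> = (\<Sum>i\<in>J. v i * (\<Sum>j\<in>J. M i j * w j))"
      using fin J zero by (intro sum.mono_neutral_right) (auto intro!: sum.neutral)
    finally show ?thesis by (simp add: bform_rows)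
  qed
  have conn_J: "\<forall>z :: 'i \<Rightarrow> real. (\<forall>i\<in>J. \<forall>j\<in>J. M i j > 0 \<longrightarrow> z i = z j)
      \<longrightarrow> (\<forall>i\<in>J. \<forall>j\<in>J. z i = z j)"
  proof (intro allI impI)
    fix z :: "'i \<Rightarrow> real" assume z: "\<forall>i\<in>J. \<forall>j\<in>J. M i j > 0 \<longrightarrow> z i = z j"
    have edges: "\<forall>i\<in>I. \<forall>j\<in>I. M i j > 0 \<longrightarrow> z i = z j"
    proof (intro ballI impI)
      fix i j assume ij: "i \<in> I" "j \<in> I" "0 < M i j"
      then have "i \<in> J" "j \<in> J" using zero[of i j] by auto
      then show "z i = z j" by (rule z[rule_format, OF _ _ ij(3)])
    qed
    show "\<forall>i\<in>J. \<forall>j\<in>J. z i = z j"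
    proof (intro ballI)
      fix i j assume "i \<in> J" "j \<in> J"
      then have "i \<in> I" "j \<in> I" "\<exists>a\<in>I. M i a > 0" "\<exists>b\<in>I. M j b > 0"
        by (simp_all add: J_def)
      then show "z i = z j"
        by (rule conn[unfolded connected_support_def, THEN spec, THEN mp, OF edges,
              THEN bspec, THEN bspec, THEN mp, THEN mp])
    qed
  qed
  have "hyperbolic J M"
  proof (rule hyperbolic_of_row_bound_positive[where u = u])
    show "0 < (\<Sum>j\<in>J. M i j * u j)" if i: "i \<in> J" for i
    proof -
      obtain a where a: "a \<in> I" "M i a > 0" using i by (auto simp: J_def)
      have "i \<in> I" using i J by blast
      then have "a \<in> J" using a zero[of i a] by fastforce
      then have "0 < M i a * u a" using a u by simp
      also have "\<dots> \<le> (\<Sum>j\<in>J. M i j * u j)"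
      proof (rule member_le_sum[OF \<open>a \<in> J\<close> _ J(2)])
        show "0 \<le> M i j * u j" if "j \<in> J - {a}" for j
          using that i J by (intro mult_nonneg_nonneg nonneg less_imp_le[OF u]) auto
      qed
      finally show ?thesis .
    qed
    fix v
    have "bform J M v v \<le> (\<Sum>i\<in>I. u i * (\<Sum>j\<in>I. M i j * v j)\<^sup>2 / (\<Sum>j\<in>I. M i j * u j))"
      using rows[of v] by (simp only: form_J)
    also have "\<dots> = (\<Sum>i\<in>I. u i * (\<Sum>j\<in>J. M i j * v j)\<^sup>2 / (\<Sum>j\<in>J. M i j * u j))"
      by (intro sum.cong refl) (simp add: row_J)
    also have "\<dots> = (\<Sum>i\<in>J. u i * (\<Sum>j\<in>J. M i j * v j)\<^sup>2 / (\<Sum>j\<in>J. M i j * u j))"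
    proof (rule sum.mono_neutral_right[OF fin J(1)], rule ballI)
      fix i assume "i \<in> I - J"
      then have "(\<Sum>j\<in>J. M i j * u j) = 0"
        using zero J by (intro sum.neutral) auto
      then show "u i * (\<Sum>j\<in>J. M i j * v j)\<^sup>2 / (\<Sum>j\<in>J. M i j * u j) = 0"
        by simp
    qed
    finally show "bform J M v v \<le> \<dots>" .
  next
    show "finite J" by (rule J)
    show "\<forall>z :: 'i \<Rightarrow> real. (\<forall>i\<in>J. \<forall>j\<in>J. M i j > 0 \<longrightarrow> z i = z j)
      \<longrightarrow> (\<forall>i\<in>J. \<forall>j\<in>J. z i = z j)" by (rule conn_J)
    show "M i j = M j i" for i j by (rule sym)
    show "0 \<le> M i j" if "i \<in> J" "j \<in> J" for i j
      using that J nonneg by blast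
    show "0 < u i" if "i \<in> J" for i
      using that J u by blast
  qed
  then show ?thesis
    by (simp add: hyperbolic_def form_J)
qed

section \<open>Directional derivatives of a homogeneous polynomial\<close>

text \<open>
  A homogeneous polynomial is represented by the function that maps a multiset of variables to the
  corresponding partial derivative of top order, a constant.  A derivative in the direction \<open>u\<close>
  lowers the degree by one, so that its value is read off on multisets with one element less.
  Multisets make the order of differentiation irrelevant.
\<close>

definition dirderiv :: "'i set \<Rightarrow> ('i \<Rightarrow> real) \<Rightarrow> ('i multiset \<Rightarrow> real) \<Rightarrow> 'i multiset \<Rightarrow> real" where
  "dirderiv I u c \<beta> = (\<Sum>r\<in>I. u r * c (add_mset r \<beta>))"

definition hessian :: "('i multiset \<Rightarrow> real) \<Rightarrow> 'i multiset \<Rightarrow> 'i \<Rightarrow> 'i \<Rightarrow> real" where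
  "hessian c \<alpha> i j = c (add_mset i (add_mset j \<alpha>))"

lemma hessian_commute: "hessian c \<alpha> i j = hessian c \<alpha> j i"
  by (simp add: hessian_def add_mset_commute)

lemma dirderiv_nonneg:
  assumes "\<And>\<beta>. 0 \<le> c \<beta>" and "\<And>i. i \<in> I \<Longrightarrow> 0 \<le> u i"
  shows "0 \<le> (dirderiv I u ^^ k) c \<beta>"
proof (induction k arbitrary: \<beta>)
  case 0
  then show ?case using assms by simp
next
  case (Suc k)
  then show ?case using assms by (auto simp: dirderiv_def intro!: sum_nonneg)
qed

text \<open>
  Here \<open>\<partial>\<^sub>i\<close> and the derivative along \<open>u\<close> are exchanged: the derivative along \<open>u\<close> becomes the second
  argument of the form with the additional \<open>\<partial>\<^sub>i\<close>.
\<close>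

lemma hessian_dirderiv_row:
  "(\<Sum>j\<in>I. hessian (dirderiv I u c) \<alpha> i j * v j) = bform I (hessian c (add_mset i \<alpha>)) v u"
proof -
  have "(\<Sum>j\<in>I. hessian (dirderiv I u c) \<alpha> i j * v j) =
      (\<Sum>j\<in>I. v j * (\<Sum>r\<in>I. hessian c (add_mset i \<alpha>) j r * u r))"
    unfolding hessian_def dirderiv_def
    by (intro sum.cong refl) (simp add: sum_distrib_left mult_ac add_mset_commute)
  then show ?thesis by (simp add: bform_rows)
qed

lemma bform_hessian_dirderiv:
  "bform I (hessian (dirderiv I u c) \<alpha>) v w = (\<Sum>r\<in>I. u r * bform I (hessian c (add_mset r \<alpha>)) v w)"
proof -
  have "bform I (hessian (dirderiv I u c) \<alpha>) v w =
      (\<Sum>i\<in>I. \<Sum>j\<in>I. \<Sum>r\<in>I. u r * (hessian c (add_mset r \<alpha>) i j * v i * w j))"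
    unfolding bform_def hessian_def dirderiv_def
    by (intro sum.cong refl) (simp add: sum_distrib_left sum_distrib_right mult_ac add_mset_commute)
  also have "\<dots> = (\<Sum>i\<in>I. \<Sum>r\<in>I. \<Sum>j\<in>I. u r * (hessian c (add_mset r \<alpha>) i j * v i * w j))"
    by (rule sum.cong[OF refl]) (rule sum.swap)
  also have "\<dots> = (\<Sum>r\<in>I. \<Sum>i\<in>I. \<Sum>j\<in>I. u r * (hessian c (add_mset r \<alpha>) i j * v i * w j))"
    by (rule sum.swap)
  finally show ?thesis
    by (simp add: bform_def sum_distrib_left)
qed

text \<open>
  Passage from partial derivatives to derivatives along a positive direction.  In the step, the form
  is the \<open>u\<close>-weighted sum of the forms with an additional \<open>\<partial>\<^sub>r\<close>; each of these is bounded by means of its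
  reverse Cauchy-Schwarz inequality against \<open>u\<close>, and the resulting bound consists of the rows of the
  form itself.
\<close>

theorem hyperbolic_hessian_dirderiv:
  assumes fin: "finite I" and nonneg: "\<And>\<beta>. 0 \<le> c \<beta>"
    and u: "\<And>i. i \<in> I \<Longrightarrow> 0 < u i"
    and quadratic: "\<And>\<alpha>. hyperbolic I (hessian c \<alpha>)"
    and conn: "\<And>k \<alpha>. connected_support I (hessian ((dirderiv I u ^^ Suc k) c) \<alpha>)"
  shows "hyperbolic I (hessian ((dirderiv I u ^^ k) c) \<alpha>)"
proof (induction k arbitrary: \<alpha>)
  case 0
  then show ?case using quadratic by simp
next
  case (Suc k)
  define c' where "c' = (dirderiv I u ^^ k) c"
  have nonneg': "0 \<le> c' \<beta>" for \<beta>
    unfolding c'_def using nonneg u by (intro dirderiv_nonneg) (auto intro: less_imp_le)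
  have hyp': "hyperbolic I (hessian c' \<beta>)" for \<beta>
    using Suc.IH by (simp add: c'_def)
  have "hyperbolic I (hessian (dirderiv I u c') \<alpha>)"
  proof (rule hyperbolic_of_row_bound[OF fin hessian_commute _ u])
    show "0 \<le> hessian (dirderiv I u c') \<alpha> i j" for i j
      using dirderiv_nonneg[of c' I u 1] nonneg' u by (simp add: hessian_def less_imp_le)
    show "connected_support I (hessian (dirderiv I u c') \<alpha>)"
      using conn[of k \<alpha>] by (simp add: c'_def)
    fix v
    have "bform I (hessian (dirderiv I u c') \<alpha>) v v =
        (\<Sum>r\<in>I. u r * bform I (hessian c' (add_mset r \<alpha>)) v v)"
      by (rule bform_hessian_dirderiv)
    also have "\<dots> \<le> (\<Sum>r\<in>I. u r * (bform I (hessian c' (add_mset r \<alpha>)) v u)\<^sup>2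
        / bform I (hessian c' (add_mset r \<alpha>)) u u)"
    \<comment> \<open>A form with nonnegative entries that vanishes at the positive vector \<open>u\<close> is zero; otherwise
      reverse Cauchy-Schwarz can be divided by its value at \<open>u\<close>.\<close>
    proof (rule sum_mono)
      fix r assume r: "r \<in> I"
      let ?H = "hessian c' (add_mset r \<alpha>)"
      have entry: "0 \<le> ?H i j * u i * u j" if "i \<in> I" "j \<in> I" for i j
        using that nonneg' u by (simp add: hessian_def less_imp_le)
      have uu: "0 \<le> bform I ?H u u"
        unfolding bform_def by (intro sum_nonneg entry)
      show "u r * bform I ?H v v \<le> u r * (bform I ?H v u)\<^sup>2 / bform I ?H u u"
      proof (cases "bform I ?H u u = 0")
        case True
        then have "?H i j * u i * u j = 0" if "i \<in> I" "j \<in> I" for i j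
          using that fin entry unfolding bform_def by (simp add: sum_nonneg_eq_0_iff sum_nonneg)
        then have "?H i j = 0" if "i \<in> I" "j \<in> I" for i j
          using that u by force
        then have "bform I ?H v v = 0"
          unfolding bform_def by (intro sum.neutral ballI) simp
        then show ?thesis using True by simp
      next
        case False
        then have pos: "0 < bform I ?H u u" using uu by simp
        then have "bform I ?H v v * bform I ?H u u \<le> (bform I ?H v u)\<^sup>2"
          using hyp' unfolding hyperbolic_def by blast
        then have "bform I ?H v v \<le> (bform I ?H v u)\<^sup>2 / bform I ?H u u"
          using pos by (simp add: pos_le_divide_eq)
        then show ?thesis
          using u[OF r] mult_left_mono[of _ _ "u r"] by fastforce
      qed
    qed
    also have "\<dots> = (\<Sum>i\<in>I. u i * (\<Sum>j\<in>I. hessian (dirderiv I u c') \<alpha> i j * v j)\<^sup>2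
        / (\<Sum>j\<in>I. hessian (dirderiv I u c') \<alpha> i j * u j))"
      by (simp only: hessian_dirderiv_row)
    finally show "bform I (hessian (dirderiv I u c') \<alpha>) v v \<le> \<dots>" .
  qed
  then show ?case by (simp add: c'_def)
qed

lemma dirderiv_Suc:
  "(dirderiv I u ^^ Suc k) c \<beta> = (\<Sum>r\<in>I. u r * (dirderiv I u ^^ k) c (add_mset r \<beta>))"
  by (simp add: dirderiv_def)

lemma dirderiv_pos_iff:
  assumes fin: "finite I" and nonneg: "\<And>\<beta>. 0 \<le> c \<beta>" and u: "\<And>i. i \<in> I \<Longrightarrow> 0 < u i"
  shows "0 < (dirderiv I u ^^ k) c \<beta> \<longleftrightarrow>
    (\<exists>\<gamma>. set_mset \<gamma> \<subseteq> I \<and> size \<gamma> = k \<and> 0 < c (\<beta> + \<gamma>))"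
proof (induction k arbitrary: \<beta>)
  case 0
  then show ?case by auto
next
  case (Suc k)
  have D: "0 \<le> (dirderiv I u ^^ k) c \<delta>" for \<delta>
    using nonneg u by (intro dirderiv_nonneg) (auto intro: less_imp_le)
  have summand: "0 \<le> u r * (dirderiv I u ^^ k) c \<delta>" if "r \<in> I" for r \<delta>
    using u[OF that] D by simp
  have "0 < (dirderiv I u ^^ Suc k) c \<beta> \<longleftrightarrow>
      (\<Sum>r\<in>I. u r * (dirderiv I u ^^ k) c (add_mset r \<beta>)) \<noteq> 0"
    using sum_nonneg[of I "\<lambda>r. u r * (dirderiv I u ^^ k) c (add_mset r \<beta>)"] summand
    unfolding dirderiv_Suc by (simp add: less_le)
  also have "\<dots> \<longleftrightarrow> (\<exists>r\<in>I. u r * (dirderiv I u ^^ k) c (add_mset r \<beta>) \<noteq> 0)"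
    using sum_nonneg_eq_0_iff[OF fin, of "\<lambda>r. u r * (dirderiv I u ^^ k) c (add_mset r \<beta>)"] summand
    by simp
  also have "\<dots> \<longleftrightarrow> (\<exists>r\<in>I. 0 < (dirderiv I u ^^ k) c (add_mset r \<beta>))"
    using u D by (metis less_irrefl less_le mult_eq_0_iff)
  also have "\<dots> \<longleftrightarrow> (\<exists>r\<in>I. \<exists>\<gamma>. set_mset \<gamma> \<subseteq> I \<and> size \<gamma> = k \<and> 0 < c (add_mset r \<beta> + \<gamma>))"
    by (simp only: Suc.IH)
  also have "\<dots> \<longleftrightarrow> (\<exists>\<gamma>. set_mset \<gamma> \<subseteq> I \<and> size \<gamma> = Suc k \<and> 0 < c (\<beta> + \<gamma>))"
  proof
    assume "\<exists>r\<in>I. \<exists>\<gamma>. set_mset \<gamma> \<subseteq> I \<and> size \<gamma> = k \<and> 0 < c (add_mset r \<beta> + \<gamma>)"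
    then obtain r \<gamma> where "r \<in> I" "set_mset \<gamma> \<subseteq> I" "size \<gamma> = k" "0 < c (add_mset r \<beta> + \<gamma>)"
      by blast
    then show "\<exists>\<gamma>. set_mset \<gamma> \<subseteq> I \<and> size \<gamma> = Suc k \<and> 0 < c (\<beta> + \<gamma>)"
      by (intro exI[of _ "add_mset r \<gamma>"]) simp
  next
    assume "\<exists>\<gamma>. set_mset \<gamma> \<subseteq> I \<and> size \<gamma> = Suc k \<and> 0 < c (\<beta> + \<gamma>)"
    then obtain \<gamma> where \<gamma>: "set_mset \<gamma> \<subseteq> I" "size \<gamma> = Suc k" "0 < c (\<beta> + \<gamma>)" by blast
    then obtain r \<gamma>' where "\<gamma> = add_mset r \<gamma>'"
      by (metis size_eq_Suc_imp_eq_union)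
    then show "\<exists>r\<in>I. \<exists>\<gamma>. set_mset \<gamma> \<subseteq> I \<and> size \<gamma> = k \<and> 0 < c (add_mset r \<beta> + \<gamma>)"
      using \<gamma> by (intro bexI[of _ r] exI[of _ \<gamma>']) auto
  qed
  finally show ?case .
qed

section \<open>Matroid ranks and parallel elements\<close>

lemma sum_equal_fibres:
  fixes W :: "'a \<Rightarrow> real"
  assumes "finite T"
  shows "(\<Sum>i\<in>T. \<Sum>l\<in>T. if p i = p l then W i * W l else 0) =
    (\<Sum>c\<in>p ` T. (\<Sum>i\<in>{i \<in> T. p i = c}. W i)\<^sup>2)"
proof -
  have "(\<Sum>i\<in>T. \<Sum>l\<in>T. if p i = p l then W i * W l else 0) =
      (\<Sum>i\<in>T. W i * (\<Sum>l\<in>{l \<in> T. p l = p i}. W l))"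
  proof (rule sum.cong[OF refl])
    fix i
    have eq: "(\<Sum>l\<in>{l \<in> T. p l = p i}. W l) = (\<Sum>l\<in>T. if p l = p i then W l else 0)"
      using assms by (rule sum.inter_filter)
    show "(\<Sum>l\<in>T. if p i = p l then W i * W l else 0) = W i * (\<Sum>l\<in>{l \<in> T. p l = p i}. W l)"
      unfolding eq sum_distrib_left by (intro sum.cong refl) auto
  qed
  also have "\<dots> = (\<Sum>c\<in>p ` T. \<Sum>i\<in>{i \<in> T. p i = c}. W i * (\<Sum>l\<in>{l \<in> T. p l = p i}. W l))"
    using assms by (rule sum.image_gen)
  also have "\<dots> = (\<Sum>c\<in>p ` T. (\<Sum>i\<in>{i \<in> T. p i = c}. W i)\<^sup>2)"
    by (rule sum.cong[OF refl]) (simp add: power2_eq_square sum_distrib_right)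
  finally show ?thesis .
qed

context matroid
begin

lemma rk_insert_le:
  assumes "S \<subseteq> E" "x \<in> E"
  shows "rk (insert x S) \<le> Suc (rk S)"
  using rk_submodular[of S "{x}"] rk_le_card[of "{x}"] assms by simp

lemma rk_insert_ge: "S \<subseteq> E \<Longrightarrow> x \<in> E \<Longrightarrow> rk S \<le> rk (insert x S)"
  by (rule rk_mono) auto

lemma rk_insert_diminishing:
  assumes "A \<subseteq> B" "B \<subseteq> E" "x \<in> E"
  shows "rk (insert x B) + rk A \<le> rk B + rk (insert x A)"
proof -
  have "rk A \<le> rk (B \<inter> insert x A)"
    using assms by (intro rk_mono) auto
  moreover have "rk (B \<union> insert x A) + rk (B \<inter> insert x A) \<le> rk B + rk (insert x A)"
    using assms by (intro rk_submodular) auto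
  moreover have "B \<union> insert x A = insert x B"
    using assms by auto
  ultimately show ?thesis by simp
qed

lemma rk_Un_eq:
  assumes X: "X \<subseteq> E" and Y: "Y \<subseteq> E" and eq: "\<And>e. e \<in> Y \<Longrightarrow> rk (insert e X) = rk X"
  shows "rk (X \<union> Y) = rk X"
proof -
  have "finite Y" using Y finite_ground by (rule finite_subset)
  then show ?thesis
    using Y eq
  proof (induction Y)
    case empty
    then show ?case by simp
  next
    case (insert e Y)
    have "rk (insert e (X \<union> Y)) + rk X \<le> rk (X \<union> Y) + rk (insert e X)"
      using insert.prems X by (intro rk_insert_diminishing) auto
    moreover have "rk (X \<union> Y) = rk X" "rk (insert e X) = rk X"
      using insert by auto
    moreover have "rk X \<le> rk (insert e (X \<union> Y))"
      using insert.prems X by (intro rk_mono) auto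
    ultimately show ?case by simp
  qed
qed

lemma rk_augment:
  assumes "X \<subseteq> E" "Y \<subseteq> E" "rk X < rk Y"
  shows "\<exists>e\<in>Y. rk (insert e X) = Suc (rk X)"
proof (rule ccontr)
  assume none: "\<not> ?thesis"
  have "rk (insert e X) = rk X" if "e \<in> Y" for e
  proof -
    have "e \<in> E" using that assms by blast
    then have "rk (insert e X) \<le> Suc (rk X)" "rk X \<le> rk (insert e X)"
      using rk_insert_le rk_insert_ge assms by auto
    moreover have "rk (insert e X) \<noteq> Suc (rk X)" using none that by blast
    ultimately show ?thesis by linarith
  qed
  then have "rk (X \<union> Y) = rk X"
    using assms by (intro rk_Un_eq) auto
  moreover have "rk Y \<le> rk (X \<union> Y)"
    using assms by (intro rk_mono) auto
  ultimately show False using assms by simp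
qed

lemma independent_subset:
  assumes "S \<subseteq> T" "T \<subseteq> E" "rk T = card T"
  shows "rk S = card S"
proof -
  have fin: "finite T" using assms finite_ground finite_subset by blast
  have "rk (S \<union> (T - S)) \<le> rk S + rk (T - S)"
  proof -
    have "rk (S \<union> (T - S)) + rk (S \<inter> (T - S)) \<le> rk S + rk (T - S)"
      using assms by (intro rk_submodular) auto
    then show ?thesis by linarith
  qed
  then have "rk T \<le> rk S + rk (T - S)"
    using assms by (simp add: Un_absorb1)
  moreover have "rk (T - S) \<le> card (T - S)" "rk S \<le> card S"
    using assms by (auto intro!: rk_le_card)
  moreover have "card T = card S + card (T - S)"
    using fin assms card_mono[OF fin assms(1)] by (simp add: card_Diff_subset finite_subset)
  ultimately show ?thesis using assms by linarith
qed

lemma independent_extends: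
  assumes "X \<subseteq> Y" "Y \<subseteq> E" "rk X = card X"
  shows "\<exists>B. X \<subseteq> B \<and> B \<subseteq> Y \<and> rk B = card B \<and> card B = rk Y"
  using assms
proof (induction "rk Y - rk X" arbitrary: X)
  case 0
  then have "rk X = rk Y"
    using rk_mono[of X Y] by simp
  then show ?case using 0 by (intro exI[of _ X]) auto
next
  case (Suc d)
  then have "rk X < rk Y" by simp
  then obtain e where e: "e \<in> Y" "rk (insert e X) = Suc (rk X)"
    using rk_augment[of X Y] Suc.prems by auto
  have fin: "finite X" using Suc.prems finite_ground by (meson finite_subset)
  have "e \<notin> X"
    using e by (metis insert_absorb n_not_Suc_n)
  then have "rk (insert e X) = card (insert e X)"
    using e fin Suc.prems by simp
  moreover have "d = rk Y - rk (insert e X)"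
    using Suc.hyps(2) e by simp
  ultimately obtain B where "insert e X \<subseteq> B" "B \<subseteq> Y" "rk B = card B" "card B = rk Y"
    using Suc.hyps(1)[of "insert e X"] Suc.prems e \<open>d = rk Y - rk (insert e X)\<close> by auto
  then show ?case by blast
qed

text \<open>
  In the contraction by \<open>A\<close>, two non-loops are parallel when together they have rank \<open>1\<close>.  Adding
  \<open>i\<close> to the set of \<open>j\<close> and \<open>k\<close> gains no more rank than adding it to \<open>j\<close> alone, that is, none; if
  \<open>j\<close> were a loop, this would not bound the rank of \<open>i\<close> and \<open>k\<close>.
\<close>

lemma parallel_trans:
  assumes "A \<subseteq> E" "i \<in> E" "j \<in> E" "k \<in> E"
    and "rk (insert i A) = Suc (rk A)" "rk (insert j A) = Suc (rk A)"
    and "rk (insert i (insert j A)) = Suc (rk A)" "rk (insert j (insert k A)) = Suc (rk A)"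
  shows "rk (insert i (insert k A)) = Suc (rk A)"
proof -
  have "rk (insert i (insert j (insert k A))) + rk (insert j A)
      \<le> rk (insert j (insert k A)) + rk (insert i (insert j A))"
    using assms by (intro rk_insert_diminishing) auto
  moreover have "rk (insert i (insert k A)) \<le> rk (insert i (insert j (insert k A)))"
    using assms by (intro rk_mono) auto
  moreover have "rk (insert i A) \<le> rk (insert i (insert k A))"
    using assms by (intro rk_mono) auto
  ultimately show ?thesis using assms by simp
qed

text \<open>
  Parallelism is an equivalence relation on the non-loops of the contraction by \<open>A\<close>, and \<open>P\<close> is the sum
  of the squares of the sums of \<open>W\<close> over its classes.  The second bound is Cauchy-Schwarz over the
  classes, of which there are at most \<open>card T\<close>.
\<close>

lemma parallel_form_bounds:
  fixes W :: "'a \<Rightarrow> real" and P :: real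
  assumes A: "A \<subseteq> E" and T: "\<And>i. i \<in> T \<Longrightarrow> i \<in> E \<and> rk (insert i A) = Suc (rk A)"
  defines "P \<equiv> \<Sum>i\<in>T. \<Sum>l\<in>T. if rk (insert i (insert l A)) = Suc (rk A) then W i * W l else 0"
  shows "0 \<le> P" and "(\<Sum>i\<in>T. W i)\<^sup>2 \<le> real (card T) * P"
proof -
  define p where "p i = {l \<in> T. rk (insert i (insert l A)) = Suc (rk A)}" for i
  have fin: "finite T"
    using T finite_ground by (meson finite_subset subsetI)
  have self: "i \<in> p i" if "i \<in> T" for i
    using T[OF that] that by (simp add: p_def)
  have sym: "insert i (insert l A) = insert l (insert i A)" for i l by auto
  have "rk (insert i (insert l A)) = Suc (rk A) \<longleftrightarrow> p i = p l" if "i \<in> T" "l \<in> T" for i l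
  proof
    assume il: "rk (insert i (insert l A)) = Suc (rk A)"
    then have li: "rk (insert l (insert i A)) = Suc (rk A)" by (simp add: sym)
    have "rk (insert i (insert k A)) = Suc (rk A) \<longleftrightarrow> rk (insert l (insert k A)) = Suc (rk A)"
      if "k \<in> T" for k
      using parallel_trans[of A i l k] parallel_trans[of A l i k] il li A
        T[OF that] T[OF \<open>i \<in> T\<close>] T[OF \<open>l \<in> T\<close>] by argo
    then show "p i = p l" unfolding p_def by blast
  next
    assume "p i = p l"
    then have "l \<in> p i" using self[OF \<open>l \<in> T\<close>] by simp
    then show "rk (insert i (insert l A)) = Suc (rk A)" by (simp add: p_def)
  qed
  then have "P = (\<Sum>i\<in>T. \<Sum>l\<in>T. if p i = p l then W i * W l else 0)"
    unfolding P_def by (intro sum.cong refl) simp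
  also have "\<dots> = (\<Sum>c\<in>p ` T. (\<Sum>i\<in>{i \<in> T. p i = c}. W i)\<^sup>2)"
    using fin by (rule sum_equal_fibres)
  finally have P: "P = (\<Sum>c\<in>p ` T. (\<Sum>i\<in>{i \<in> T. p i = c}. W i)\<^sup>2)" .
  show nonneg: "0 \<le> P"
    unfolding P by (intro sum_nonneg) simp
  have "(\<Sum>i\<in>T. W i)\<^sup>2 = (\<Sum>c\<in>p ` T. \<Sum>i\<in>{i \<in> T. p i = c}. W i)\<^sup>2"
    using sum.image_gen[OF fin, of W p] by simp
  also have "\<dots> \<le> P * card (p ` T)"
    unfolding P by (rule sum_squared_le_sum_of_squares)
  also have "\<dots> \<le> P * card T"
    using nonneg fin by (intro mult_left_mono) (auto simp: card_image_le)
  finally show "(\<Sum>i\<in>T. W i)\<^sup>2 \<le> real (card T) * P" by (simp add: mult_ac)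
qed

end

section \<open>Matroid quotients and their bases\<close>

locale matroid_quotient = M: matroid E r + Q: matroid E g
  for E :: "'a set" and r g :: "'a set \<Rightarrow> nat" +
  assumes quotient: "S \<subseteq> T \<Longrightarrow> T \<subseteq> E \<Longrightarrow> g T + r S \<le> g S + r T"
begin

text \<open>
  For the quotient defined by a morphism whose image spans the target, these are the bases of the
  morphism.  They may have different cardinalities.
\<close>

definition basis :: "'a set \<Rightarrow> bool" where
  "basis S \<longleftrightarrow> S \<subseteq> E \<and> r S = card S \<and> g S = g E"

lemma fin: "finite E"
  by (rule M.finite_ground)

lemma basis_finite: "basis S \<Longrightarrow> finite S"
  using fin finite_subset by (auto simp: basis_def)

lemma spanning_superset: "S \<subseteq> T \<Longrightarrow> T \<subseteq> E \<Longrightarrow> g S = g E \<Longrightarrow> g T = g E"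
  using Q.rk_mono[of S T] Q.rk_mono[of T E] by simp

text \<open>
  The quotient condition bounds the gain in \<open>g\<close> by the gain in \<open>r\<close>.
\<close>

lemma r_insert_of_g_insert:
  assumes "S \<subseteq> E" "x \<in> E" "g (insert x S) = Suc (g S)"
  shows "r (insert x S) = Suc (r S)"
  using quotient[OF subset_insertI, of x S] M.rk_insert_le[of S x] assms by simp

lemma basis_augment:
  assumes "basis T" "basis S" "card T < card S"
  shows "\<exists>e\<in>S - T. basis (insert e T)"
proof -
  obtain e where e: "e \<in> S" "r (insert e T) = Suc (r T)"
    using M.rk_augment[of T S] assms unfolding basis_def by metis
  have "e \<notin> T"
    using e by (metis insert_absorb n_not_Suc_n)
  moreover have "basis (insert e T)"
    unfolding basis_def
  proof (intro conjI)
    show sub: "insert e T \<subseteq> E"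
      using e assms by (auto simp: basis_def)
    show "r (insert e T) = card (insert e T)"
      using e \<open>e \<notin> T\<close> assms(1) basis_finite[OF assms(1)] by (simp add: basis_def)
    show "g (insert e T) = g E"
      using spanning_superset[OF subset_insertI sub] assms(1) by (simp add: basis_def)
  qed
  ultimately show ?thesis using e by blast
qed

lemma basis_extends:
  assumes "basis S0" "basis S" "card S0 \<le> m" "m \<le> card S"
  shows "\<exists>T. S0 \<subseteq> T \<and> basis T \<and> card T = m"
  using assms
proof (induction "m - card S0" arbitrary: S0)
  case 0
  then show ?case by auto
next
  case (Suc d)
  then have "card S0 < card S" by linarith
  then obtain e where e: "e \<in> S - S0" "basis (insert e S0)"
    using basis_augment[of S0 S] Suc.prems by blast
  have "card (insert e S0) = Suc (card S0)"
    using e basis_finite Suc.prems by simp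
  then have "d = m - card (insert e S0)" "card (insert e S0) \<le> m"
    using Suc.hyps(2) by linarith+
  then obtain T where "insert e S0 \<subseteq> T" "basis T" "card T = m"
    using Suc.hyps(1)[of "insert e S0"] Suc.prems e by blast
  then show ?case by blast
qed

text \<open>
  If \<open>y\<close> cannot be dropped from \<open>T\<close>, the remainder has corank \<open>1\<close> in the quotient, and any element
  of \<open>S\<close> outside its closure restores the rank.  Such an element also preserves independence in the
  first matroid.
\<close>

lemma basis_exchange:
  assumes T: "basis T" "y \<in> T" and S: "basis S" and not: "\<not> basis (T - {y})"
  shows "\<exists>e\<in>S. e \<notin> T - {y} \<and> basis (insert e (T - {y}))"
proof -
  let ?U = "T - {y}"
  have U: "?U \<subseteq> E" "y \<in> E" "insert y ?U = T" using T by (auto simp: basis_def)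
  have indep: "r ?U = card ?U"
    using M.independent_subset[of ?U T] T by (auto simp: basis_def)
  then have "g ?U \<noteq> g E"
    using not U by (simp add: basis_def)
  then have less: "g ?U < g E"
    using Q.rk_mono[of ?U E] U by simp
  have "g E \<le> Suc (g ?U)"
    using Q.rk_insert_le[of ?U y] U T by (simp add: basis_def)
  moreover obtain e where e: "e \<in> S" "g (insert e ?U) = Suc (g ?U)"
    using Q.rk_augment[of ?U S] less S U by (auto simp: basis_def)
  moreover have eE: "e \<in> E" using e S by (auto simp: basis_def)
  moreover have "r (insert e ?U) = Suc (r ?U)"
    using r_insert_of_g_insert[of ?U e] e eE U by simp
  moreover have "e \<notin> ?U"
    using e by (metis insert_absorb n_not_Suc_n)
  ultimately show ?thesis
    using e less indep basis_finite[OF T(1)] U eE unfolding basis_def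
    by (intro bexI[of _ e] conjI) simp_all
qed

text \<open>
  When \<open>T\<close> is a smallest basis above \<open>A\<close>, exchanging some element other than \<open>l\<close> for an element of \<open>S\<close>
  gives a basis that links \<open>l\<close> to \<open>S\<close>.
\<close>

lemma basis_chain_links:
  assumes S: "basis S" and T: "basis T" and AS: "A \<subseteq> S" and AT: "A \<subseteq> T"
    and l: "l \<in> T - A" and two: "card A + 2 \<le> card T"
    and minimal: "\<And>U. basis U \<Longrightarrow> A \<subseteq> U \<Longrightarrow> card T \<le> card U"
  shows "\<exists>U e. basis U \<and> A \<subseteq> U \<and> card U = card T \<and> l \<in> U \<and> e \<in> U \<and> e \<in> S - A \<and> e \<noteq> l"
proof -
  have fT: "finite T" using T by (rule basis_finite)
  have "card (T - A) = card T - card A"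
    using fT AT by (simp add: card_Diff_subset finite_subset)
  then have "card (T - A - {l}) > 0"
    using two l fT by simp
  then obtain y where y: "y \<in> T - A" "y \<noteq> l"
    by (metis DiffE card_gt_0_iff ex_in_conv insertCI)
  have "card (T - {y}) < card T"
    using y fT by (meson DiffD1 card_Diff1_less)
  then have "\<not> basis (T - {y})"
    using minimal[of "T - {y}"] y AT by auto
  then obtain e where e: "e \<in> S" "e \<notin> T - {y}" "basis (insert e (T - {y}))"
    using basis_exchange[OF T _ S] y by blast
  have "card (insert e (T - {y})) = card T"
    using e fT y card_Suc_Diff1[of T y] by simp
  moreover have "e \<notin> A"
    using e y AT by auto
  moreover have "e \<noteq> l"
    using e l y by auto
  ultimately show ?thesis
    using e y l AT by (intro exI[of _ "insert e (T - {y})"] exI[of _ e]) auto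
qed

end

section \<open>The polynomial of a matroid quotient\<close>

text \<open>
  The variable \<open>None\<close> homogenises; \<open>Some i\<close> is the variable of the ground set element \<open>i\<close>.  The
  monomials that occur are squarefree in the latter variables.
\<close>

definition set_part :: "'a option multiset \<Rightarrow> 'a set" where
  "set_part \<beta> = {i. Some i \<in># \<beta>}"

definition squarefree_part :: "'a option multiset \<Rightarrow> bool" where
  "squarefree_part \<beta> \<longleftrightarrow> (\<forall>i. count \<beta> (Some i) \<le> 1)"

lemma set_part_simps [simp]:
  "set_part {#} = {}"
  "set_part (add_mset None \<beta>) = set_part \<beta>"
  "set_part (add_mset (Some i) \<beta>) = insert i (set_part \<beta>)"
  by (auto simp: set_part_def)

lemma squarefree_part_simps [simp]:
  "squarefree_part {#}"
  "squarefree_part (add_mset None \<beta>) \<longleftrightarrow> squarefree_part \<beta>"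
  "squarefree_part (add_mset (Some i) \<beta>) \<longleftrightarrow> squarefree_part \<beta> \<and> i \<notin> set_part \<beta>"
proof -
  show "squarefree_part (add_mset (Some i) \<beta>) \<longleftrightarrow> squarefree_part \<beta> \<and> i \<notin> set_part \<beta>"
  proof
    assume *: "squarefree_part (add_mset (Some i) \<beta>)"
    have "count \<beta> (Some j) \<le> 1" for j
      using *[unfolded squarefree_part_def, rule_format, of j] by (simp split: if_splits)
    moreover have "count \<beta> (Some i) = 0"
      using *[unfolded squarefree_part_def, rule_format, of i] by simp
    ultimately show "squarefree_part \<beta> \<and> i \<notin> set_part \<beta>"
      by (auto simp: squarefree_part_def set_part_def not_in_iff)
  next
    assume *: "squarefree_part \<beta> \<and> i \<notin> set_part \<beta>"
    then have "count \<beta> (Some i) = 0" by (auto simp: set_part_def not_in_iff)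
    with * show "squarefree_part (add_mset (Some i) \<beta>)"
      by (auto simp: squarefree_part_def)
  qed
qed (auto simp: squarefree_part_def)

lemma finite_set_part [simp]: "finite (set_part \<beta>)"
  by (induction \<beta>) (auto simp: set_part_def[symmetric], metis (full_types) finite.insertI not_Some_eq set_part_simps(2,3))

lemma size_squarefree_part:
  "squarefree_part \<beta> \<Longrightarrow> size \<beta> = count \<beta> None + card (set_part \<beta>)"
proof (induction \<beta>)
  case empty
  then show ?case by simp
next
  case (add x \<beta>)
  then show ?case by (cases x) auto
qed

lemma count_squarefree_part:
  assumes "squarefree_part \<beta>"
  shows "count \<beta> (Some i) = (if i \<in> set_part \<beta> then 1 else 0)"
proof -
  have "count \<beta> (Some i) \<le> 1"
    using assms by (simp add: squarefree_part_def)
  moreover have "count \<beta> (Some i) = 0 \<longleftrightarrow> i \<notin> set_part \<beta>"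
    by (simp add: set_part_def not_in_iff)
  ultimately show ?thesis by auto
qed

lemma sum_of_bool_mult:
  fixes w :: "'a \<Rightarrow> real"
  assumes "finite E" "T \<subseteq> E"
  shows "(\<Sum>i\<in>E. of_bool (i \<in> T) * w i) = (\<Sum>i\<in>T. w i)"
proof -
  have "(\<Sum>i\<in>E. of_bool (i \<in> T) * w i) = (\<Sum>i\<in>E. if i \<in> T then w i else 0)"
    by (intro sum.cong refl) simp
  also have "\<dots> = (\<Sum>i\<in>T. w i)"
    using sum.inter_restrict[OF assms(1), of w T] assms(2) by (simp add: Int_absorb1)
  finally show ?thesis .
qed

lemma bform_option:
  assumes fin: "finite E" and sym: "\<And>i j. M i j = M j i"
  shows "bform (insert None (Some ` E)) M v v =
    M None None * (v None)\<^sup>2 + 2 * v None * (\<Sum>i\<in>E. M None (Some i) * v (Some i))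
    + (\<Sum>i\<in>E. \<Sum>l\<in>E. M (Some i) (Some l) * v (Some i) * v (Some l))"
proof -
  have split: "(\<Sum>x\<in>insert None (Some ` E). h x) = h None + (\<Sum>i\<in>E. h (Some i))"
    for h :: "'a option \<Rightarrow> real"
    using fin by (simp add: sum.reindex)
  have "(\<Sum>i\<in>E. M (Some i) None * v (Some i) * v None) =
      (\<Sum>i\<in>E. M None (Some i) * v None * v (Some i))"
    by (intro sum.cong refl) (use sym in \<open>simp add: mult_ac\<close>)
  moreover have "(\<Sum>i\<in>E. M None (Some i) * v None * v (Some i)) =
      v None * (\<Sum>i\<in>E. M None (Some i) * v (Some i))"
    by (simp add: sum_distrib_left mult_ac)
  ultimately show ?thesis
    unfolding bform_def split sum.distrib by (simp add: power2_eq_square)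
qed

text \<open>
  The shape of all the quadratic forms that arise from contractions: the pairs in \<open>T\<close> that are not
  related by \<open>q\<close>, and all pairs between \<open>T\<close> and \<open>R\<close>.
\<close>

lemma sum_indicator_pattern:
  fixes w :: "'a \<Rightarrow> real"
  assumes fin: "finite E" and T: "T \<subseteq> E" and R: "R \<subseteq> E"
    and K: "\<And>i l. i \<in> E \<Longrightarrow> l \<in> E \<Longrightarrow>
      K i l = a * (of_bool (i \<in> T \<and> l \<in> T \<and> \<not> q i l) + of_bool (i \<in> T \<and> l \<in> R) + of_bool (i \<in> R \<and> l \<in> T))"
  shows "(\<Sum>i\<in>E. \<Sum>l\<in>E. K i l * w i * w l) =
    a * ((\<Sum>i\<in>T. w i)\<^sup>2 - (\<Sum>i\<in>T. \<Sum>l\<in>T. if q i l then w i * w l else 0)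
      + 2 * (\<Sum>i\<in>T. w i) * (\<Sum>i\<in>R. w i))"
proof -
  define t where "t i = (if i \<in> T then w i else 0)" for i
  define s where "s i = (if i \<in> R then w i else 0)" for i
  define z where "z i l = (if i \<in> T then if l \<in> T then if q i l then w i * w l else 0 else 0 else 0)" for i l
  have t: "(\<Sum>i\<in>E. t i) = (\<Sum>i\<in>T. w i)"
    using sum.inter_restrict[OF fin, of w T] T by (simp add: t_def Int_absorb1)
  have s: "(\<Sum>i\<in>E. s i) = (\<Sum>i\<in>R. w i)"
    using sum.inter_restrict[OF fin, of w R] R by (simp add: s_def Int_absorb1)
  have z: "(\<Sum>i\<in>E. \<Sum>l\<in>E. z i l) = (\<Sum>i\<in>T. \<Sum>l\<in>T. if q i l then w i * w l else 0)"
  proof -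
    have inner: "(\<Sum>l\<in>E. if l \<in> T then h l else 0) = (\<Sum>l\<in>T. h l)" for h :: "'a \<Rightarrow> real"
      using sum.inter_restrict[OF fin, of h T] T by (simp add: Int_absorb1)
    have "(\<Sum>i\<in>E. \<Sum>l\<in>E. z i l) =
        (\<Sum>i\<in>E. if i \<in> T then \<Sum>l\<in>E. if l \<in> T then if q i l then w i * w l else 0 else 0 else 0)"
      unfolding z_def by (intro sum.cong refl) simp
    then show ?thesis by (simp only: inner)
  qed
  have "(\<Sum>i\<in>E. \<Sum>l\<in>E. K i l * w i * w l) =
      (\<Sum>i\<in>E. \<Sum>l\<in>E. a * (t i * t l - z i l + t i * s l + s i * t l))"
    by (intro sum.cong refl) (auto simp: K t_def s_def z_def algebra_simps)
  also have "\<dots> = a * ((\<Sum>i\<in>E. t i) * (\<Sum>i\<in>E. t i) - (\<Sum>i\<in>E. \<Sum>l\<in>E. z i l)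
      + (\<Sum>i\<in>E. t i) * (\<Sum>i\<in>E. s i) + (\<Sum>i\<in>E. s i) * (\<Sum>i\<in>E. t i))"
    by (simp add: sum_product sum_distrib_left[symmetric] sum.distrib sum_subtractf)
  finally show ?thesis
    unfolding t s z by (simp add: power2_eq_square algebra_simps)
qed

context matroid_quotient
begin

text \<open>
  The partial derivatives of order \<open>n\<close> of \<open>\<Sum>\<^sub>S w\<^sub>0 ^ (n - |S|) * \<Prod>\<^bsub>i\<in>S\<^esub> w\<^sub>i\<close>, summed over the bases \<open>S\<close>.
  The factorial comes from differentiating the power of \<open>w\<^sub>0\<close>.
\<close>

definition coeff :: "'a option multiset \<Rightarrow> real" where
  "coeff \<beta> = (if size \<beta> = card E \<and> squarefree_part \<beta> \<and> basis (set_part \<beta>)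
    then fact (count \<beta> None) else 0)"

abbreviation vars :: "'a option set" where
  "vars \<equiv> insert None (Some ` E)"

lemma finite_vars: "finite vars"
  using fin by simp

lemma coeff_nonneg: "0 \<le> coeff \<beta>"
  by (simp add: coeff_def)

lemma hyperbolic_zero: "(\<And>i j. i \<in> I \<Longrightarrow> j \<in> I \<Longrightarrow> M i j = 0) \<Longrightarrow> hyperbolic I M"
  by (simp add: hyperbolic_def bform_def)

text \<open>
  Let \<open>A\<close> be the set of ground set elements in \<open>\<alpha>\<close> and \<open>a\<close> the multiplicity of \<open>w\<^sub>0\<close>, so that
  \<open>|E - A| = a + 2\<close>.  The form vanishes unless \<open>A\<close> is independent of corank at most \<open>2\<close> in the quotient.
  Up to the factor \<open>a!\<close>, and with \<open>P\<close> the sum of the squares of the class sums of the relevant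
  parallelism, \<open>e\<close> the sum of the coordinates in \<open>T\<close>, and \<open>e\<^sub>R\<close> that over \<open>R\<close>, the form is
  
    \<^item> corank \<open>0\<close>: \<open>(a+2)(a+1) w\<^sub>0\<^sup>2 + 2 (a+1) w\<^sub>0 e + e\<^sup>2 - P\<close>;
    \<^item> corank \<open>1\<close>: \<open>2 (a+1) w\<^sub>0 e + e\<^sup>2 - P + 2 e e\<^sub>R\<close>;
    \<^item> corank \<open>2\<close>: \<open>e\<^sup>2 - P\<close>.
  
  On the hyperplane \<open>(a+2) w\<^sub>0 + e = 0\<close>, respectively \<open>e = 0\<close>, it is \<open>e\<^sup>2 / (a+2) - P\<close>, respectively \<open>- P\<close>.
  The first is nonpositive because there are at most \<open>a + 2\<close> parallel classes.
\<close>

lemma hyperbolic_hessian_coeff: "hyperbolic vars (hessian coeff \<alpha>)"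
proof -
  define A where "A = set_part \<alpha>"
  define a where "a = count \<alpha> None"
  let ?H = "hessian coeff \<alpha>"
  show ?thesis
  proof (cases "squarefree_part \<alpha> \<and> size \<alpha> + 2 = card E \<and> A \<subseteq> E \<and> r A = card A \<and> g E \<le> g A + 2")
    case False
    have "?H x y = 0" if "x \<in> vars" "y \<in> vars" for x y
    proof (rule ccontr)
      assume "?H x y \<noteq> 0"
      then have *: "size \<alpha> + 2 = card E" "squarefree_part (add_mset x (add_mset y \<alpha>))"
        "basis (set_part (add_mset x (add_mset y \<alpha>)))"
        by (auto simp: hessian_def coeff_def split: if_splits)
      define S where "S = set_part (add_mset x (add_mset y \<alpha>))"
      have "squarefree_part \<alpha>" using *(2) by (cases x; cases y) auto
      moreover have S: "A \<subseteq> S" unfolding S_def A_def by (cases x; cases y) auto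
      moreover have SE: "S \<subseteq> E" "r S = card S" "g S = g E" using *(3) by (auto simp: S_def basis_def)
      moreover have "r A = card A"
        using M.independent_subset[OF S SE(1,2)] .
      moreover have "g S \<le> g A + 2"
      proof (cases x; cases y)
        fix i l assume xy: "x = Some i" "y = Some l"
        then show ?thesis
          using Q.rk_insert_le[of A l] Q.rk_insert_le[of "insert l A" i] SE
          by (simp add: S_def A_def)
      next
        fix i assume xy: "x = Some i" "y = None"
        then show ?thesis
          using Q.rk_insert_le[of A i] SE by (simp add: S_def A_def)
      next
        fix i assume xy: "x = None" "y = Some i"
        then show ?thesis
          using Q.rk_insert_le[of A i] SE by (simp add: S_def A_def)
      qed (simp add: S_def A_def)
      ultimately show False
        using False *(1) by auto
    qed
    then show ?thesis by (rule hyperbolic_zero)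
  next
    case True
    then have sf: "squarefree_part \<alpha>" and size: "size \<alpha> + 2 = card E" and A: "A \<subseteq> E"
      and rA: "r A = card A" and corank: "g E \<le> g A + 2" by auto
    have finA: "finite A" by (simp add: A_def)
    have size_a: "a + card A + 2 = card E"
      using size size_squarefree_part[OF sf] by (simp add: a_def A_def)
    have H00: "?H None None = (if basis A then fact (a + 2) else 0)"
      using sf size by (simp add: hessian_def coeff_def A_def a_def)
    have H0: "?H None (Some i) = (if i \<notin> A \<and> basis (insert i A) then fact (a + 1) else 0)" for i
      using sf size by (simp add: hessian_def coeff_def A_def a_def)
    have H: "?H (Some i) (Some l) =
        (if i \<notin> A \<and> l \<notin> A \<and> i \<noteq> l \<and> basis (insert i (insert l A)) then fact a else 0)" for i l
      using sf size by (auto simp: hessian_def coeff_def A_def a_def)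
    have facts: "fact (a + 2) = (real a + 2) * (real a + 1) * fact a" "fact (a + 1) = (real a + 1) * fact a"
      by (simp_all add: algebra_simps)
    have pos: "0 < (fact a :: real)" by simp
    note form = bform_option[of E ?H, OF fin hessian_commute]
    have out: "i \<notin> A" if "r (insert i A) = Suc (r A)" for i
      using that by (metis insert_absorb n_not_Suc_n)
    have outg: "i \<notin> A" if "g (insert i A) = Suc (g A)" for i
      using that by (metis insert_absorb n_not_Suc_n)
    have indep2: "r (insert i (insert l A)) = card (insert i (insert l A)) \<and> i \<notin> A \<and> l \<notin> A \<and> i \<noteq> l
        \<longleftrightarrow> r (insert i A) = Suc (r A) \<and> r (insert l A) = Suc (r A) \<and> r (insert i (insert l A)) \<noteq> Suc (r A)"
      if il: "i \<in> E" "l \<in> E" for i l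
    proof
      assume *: "r (insert i (insert l A)) = card (insert i (insert l A)) \<and> i \<notin> A \<and> l \<notin> A \<and> i \<noteq> l"
      have "r (insert i A) = card (insert i A)" "r (insert l A) = card (insert l A)"
        using * il A by (auto intro!: M.independent_subset[of _ "insert i (insert l A)"])
      then show "r (insert i A) = Suc (r A) \<and> r (insert l A) = Suc (r A) \<and> r (insert i (insert l A)) \<noteq> Suc (r A)"
        using * finA rA by simp
    next
      assume *: "r (insert i A) = Suc (r A) \<and> r (insert l A) = Suc (r A) \<and> r (insert i (insert l A)) \<noteq> Suc (r A)"
      then have "i \<notin> A" "l \<notin> A" "i \<noteq> l" using out by auto
      moreover have "r (insert i (insert l A)) \<le> Suc (r (insert l A))"
        using il A by (intro M.rk_insert_le) auto
      moreover have "r (insert l A) \<le> r (insert i (insert l A))"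
        using il A by (intro M.rk_insert_ge) auto
      ultimately show "r (insert i (insert l A)) = card (insert i (insert l A)) \<and> i \<notin> A \<and> l \<notin> A \<and> i \<noteq> l"
        using * rA finA by simp
    qed
    consider (0) "g A = g E" | (1) "g E = Suc (g A)" | (2) "g E = g A + 2"
      using corank Q.rk_mono[of A E] A by fastforce
    then show ?thesis
    proof cases
      case 0
      define T where "T = {i \<in> E. r (insert i A) = Suc (r A)}"
      have T: "T \<subseteq> E" and T': "\<And>i. i \<in> T \<Longrightarrow> i \<in> E \<and> r (insert i A) = Suc (r A)"
        by (auto simp: T_def)
      have sp: "g (insert i A) = g E" "g (insert i (insert l A)) = g E" if "i \<in> E" "l \<in> E" for i l
        using that A 0 by (auto intro!: spanning_superset[of A])
      have K0: "?H None (Some i) = (real a + 1) * fact a * of_bool (i \<in> T)" if "i \<in> E" for i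
        unfolding H0 facts using that A out rA finA sp(1)[OF that that]
        by (auto simp: basis_def T_def)
      have K: "?H (Some i) (Some l) = fact a * (of_bool (i \<in> T \<and> l \<in> T \<and> \<not> r (insert i (insert l A)) = Suc (r A))
          + of_bool (i \<in> T \<and> l \<in> {}) + of_bool (i \<in> {} \<and> l \<in> T))" if "i \<in> E" "l \<in> E" for i l
        unfolding H using that A sp[OF that] indep2[OF that] by (auto simp: basis_def T_def)
      have cardT: "card T \<le> a + 2"
      proof -
        have "card T \<le> card (E - A)"
          using fin out by (intro card_mono) (auto simp: T_def)
        also have "card (E - A) = a + 2"
          using size_a A finA by (simp add: card_Diff_subset)
        finally show ?thesis .
      qed
      show ?thesis
      proof (rule hyperbolic_if_nonpos_on_hyperplane[OF hessian_commute,
            where h = "\<lambda>x. case x of None \<Rightarrow> real a + 2 | Some i \<Rightarrow> of_bool (i \<in> T)"])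
        fix v :: "'a option \<Rightarrow> real"
        define w where "w i = v (Some i)" for i
        define e where "e = (\<Sum>i\<in>T. w i)"
        define P where "P = (\<Sum>i\<in>T. \<Sum>l\<in>T. if r (insert i (insert l A)) = Suc (r A) then w i * w l else 0)"
        have sumT: "(\<Sum>i\<in>E. of_bool (i \<in> T) * w i) = e"
          unfolding e_def by (rule sum_of_bool_mult[OF fin T])
        assume "(\<Sum>x\<in>vars. (case x of None \<Rightarrow> real a + 2 | Some i \<Rightarrow> of_bool (i \<in> T)) * v x) = 0"
        then have "(real a + 2) * v None + e = 0"
          using fin by (simp add: sum.reindex sumT[symmetric] w_def)
        then have e: "e = - ((real a + 2) * v None)" by linarith
        have P: "0 \<le> P" "e\<^sup>2 \<le> real (card T) * P"
          unfolding P_def e_def using M.parallel_form_bounds[OF A T'] by blast+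
        have "bform vars ?H v v = fact (a + 2) * (v None)\<^sup>2 + 2 * v None * ((real a + 1) * fact a * e)
            + fact a * (e\<^sup>2 - P)"
        proof -
          have "(\<Sum>i\<in>E. ?H None (Some i) * v (Some i)) = (real a + 1) * fact a * e"
            unfolding sumT[symmetric] sum_distrib_left
            by (intro sum.cong refl) (simp add: K0 w_def)
          moreover have "basis A" using 0 A rA by (simp add: basis_def)
          moreover have "(\<Sum>i\<in>E. \<Sum>l\<in>E. ?H (Some i) (Some l) * v (Some i) * v (Some l)) = fact a * (e\<^sup>2 - P)"
            using sum_indicator_pattern[where w = w, OF fin T _ K] by (simp add: w_def e_def P_def)
          ultimately show ?thesis unfolding form H00 by simp
        qed
        also have "\<dots> = fact a * ((real a + 2) * (v None)\<^sup>2 - P)"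
          unfolding facts e by (simp add: power2_eq_square algebra_simps)
        also have "\<dots> \<le> 0"
        proof -
          have "(real a + 2) * ((real a + 2) * (v None)\<^sup>2) = e\<^sup>2"
            by (simp add: e power2_eq_square algebra_simps)
          also have "\<dots> \<le> real (card T) * P" by (rule P)
          also have "\<dots> \<le> (real a + 2) * P"
          proof (rule mult_right_mono[OF _ P(1)])
            have "real (card T) \<le> real (a + 2)" using cardT by (rule of_nat_mono)
            then show "real (card T) \<le> real a + 2" by simp
          qed
          finally have "(real a + 2) * (v None)\<^sup>2 \<le> P" by simp
          then show ?thesis by (simp add: mult_nonneg_nonpos)
        qed
        finally show "bform vars ?H v v \<le> 0" .
      qed
    next
      case 1
      define T where "T = {i \<in> E. g (insert i A) = Suc (g A)}"
      define R where "R = {i \<in> E - T. r (insert i A) = Suc (r A)}"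
      have T: "T \<subseteq> E" and R: "R \<subseteq> E" by (auto simp: T_def R_def)
      have T': "\<And>i. i \<in> T \<Longrightarrow> i \<in> E \<and> r (insert i A) = Suc (r A)"
        using r_insert_of_g_insert[OF A] by (auto simp: T_def)
      have loop: "g (insert i A) = g A" if "i \<in> E" "i \<notin> T" for i
        using that Q.rk_insert_le[of A i] Q.rk_insert_ge[of A i] A by (auto simp: T_def le_Suc_eq)
      have sp: "g (insert i (insert l A)) = g E \<longleftrightarrow> i \<in> T \<or> l \<in> T" if il: "i \<in> E" "l \<in> E" for i l
      proof
        assume sp: "g (insert i (insert l A)) = g E"
        show "i \<in> T \<or> l \<in> T"
        proof (rule ccontr)
          assume "\<not> ?thesis"
          then have "g (insert i A) = g A" "g (insert l A) = g A" using loop il by auto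
          moreover have "g (insert i (insert l A)) + g A \<le> g (insert l A) + g (insert i A)"
            using il A by (intro Q.rk_insert_diminishing) auto
          ultimately show False using sp 1 by simp
        qed
      next
        assume "i \<in> T \<or> l \<in> T"
        then have "g (insert i A) = g E \<or> g (insert l A) = g E" using 1 by (auto simp: T_def)
        then show "g (insert i (insert l A)) = g E"
          using spanning_superset[of "insert i A" "insert i (insert l A)"]
            spanning_superset[of "insert l A" "insert i (insert l A)"] il A by auto
      qed
      \<comment> \<open>An element parallel to a loop of the quotient is itself a loop of the quotient, so that no
        parallel class meets both \<open>T\<close> and \<open>R\<close>.\<close>
      have TR: "r (insert i (insert l A)) \<noteq> Suc (r A)"
        if il: "i \<in> T" "l \<in> R" for i l
      proof
        assume "r (insert i (insert l A)) = Suc (r A)"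
        moreover have "r (insert l A) = Suc (r A)" "l \<in> E" "l \<notin> T" using il by (auto simp: R_def)
        moreover have "g (insert i (insert l A)) + r (insert l A) \<le> g (insert l A) + r (insert i (insert l A))"
          using il T R A by (intro quotient) auto
        moreover have "g (insert i (insert l A)) = g E" using sp il T R by blast
        ultimately show False using loop[of l] 1 by simp
      qed
      have K0: "?H None (Some i) = (real a + 1) * fact a * of_bool (i \<in> T)" if "i \<in> E" for i
      proof -
        have "i \<notin> A \<and> basis (insert i A) \<longleftrightarrow> i \<in> T"
        proof
          assume "i \<in> T"
          then show "i \<notin> A \<and> basis (insert i A)"
            using outg[of i] T'[of i] A finA rA 1 by (auto simp: T_def basis_def)
        next
          assume "i \<notin> A \<and> basis (insert i A)"
          then show "i \<in> T" using 1 that by (auto simp: T_def basis_def)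
        qed
        then show ?thesis unfolding H0 facts by simp
      qed
      have K: "?H (Some i) (Some l) = fact a * (of_bool (i \<in> T \<and> l \<in> T \<and> \<not> r (insert i (insert l A)) = Suc (r A))
          + of_bool (i \<in> T \<and> l \<in> R) + of_bool (i \<in> R \<and> l \<in> T))" if "i \<in> E" "l \<in> E" for i l
      proof -
        have sym: "insert l (insert i A) = insert i (insert l A)" by auto
        have "i \<notin> A \<and> l \<notin> A \<and> i \<noteq> l \<and> basis (insert i (insert l A)) \<longleftrightarrow>
            (i \<in> T \<or> l \<in> T) \<and> r (insert i A) = Suc (r A) \<and> r (insert l A) = Suc (r A)
              \<and> r (insert i (insert l A)) \<noteq> Suc (r A)"
          unfolding basis_def sp[OF that] using indep2[OF that] that A by auto
        also have "\<dots> \<longleftrightarrow> (i \<in> T \<and> l \<in> T \<and> \<not> r (insert i (insert l A)) = Suc (r A))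
            \<or> (i \<in> T \<and> l \<in> R) \<or> (i \<in> R \<and> l \<in> T)"
          using T'[of i] T'[of l] TR[of i l] TR[of l i] that unfolding sym R_def by auto
        finally have "i \<notin> A \<and> l \<notin> A \<and> i \<noteq> l \<and> basis (insert i (insert l A)) \<longleftrightarrow> \<dots>" .
        moreover have "T \<inter> R = {}" by (auto simp: R_def)
        ultimately show ?thesis unfolding H by (auto simp: disjoint_iff)
      qed
      show ?thesis
      proof (rule hyperbolic_if_nonpos_on_hyperplane[OF hessian_commute,
            where h = "\<lambda>x. case x of None \<Rightarrow> 0 | Some i \<Rightarrow> of_bool (i \<in> T)"])
        fix v :: "'a option \<Rightarrow> real"
        define w where "w i = v (Some i)" for i
        define e where "e = (\<Sum>i\<in>T. w i)"
        define P where "P = (\<Sum>i\<in>T. \<Sum>l\<in>T. if r (insert i (insert l A)) = Suc (r A) then w i * w l else 0)"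
        have sumT: "(\<Sum>i\<in>E. of_bool (i \<in> T) * w i) = e"
          unfolding e_def by (rule sum_of_bool_mult[OF fin T])
        assume "(\<Sum>x\<in>vars. (case x of None \<Rightarrow> 0 | Some i \<Rightarrow> of_bool (i \<in> T)) * v x) = 0"
        then have e: "e = 0"
          using fin by (simp add: sum.reindex sumT[symmetric] w_def)
        have P: "0 \<le> P"
          unfolding P_def using M.parallel_form_bounds(1)[OF A T'] by blast
        have "bform vars ?H v v = - fact a * P"
        proof -
          have "(\<Sum>i\<in>E. ?H None (Some i) * v (Some i)) = (real a + 1) * fact a * e"
            unfolding sumT[symmetric] sum_distrib_left
            by (intro sum.cong refl) (simp add: K0 w_def)
          moreover have "\<not> basis A" using 1 by (simp add: basis_def)
          moreover have "(\<Sum>i\<in>E. \<Sum>l\<in>E. ?H (Some i) (Some l) * v (Some i) * v (Some l))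
              = fact a * (e\<^sup>2 - P + 2 * e * (\<Sum>i\<in>R. w i))"
            using sum_indicator_pattern[where w = w, OF fin T R K] by (simp add: w_def e_def P_def)
          ultimately show ?thesis unfolding form H00 by (simp add: e)
        qed
        then show "bform vars ?H v v \<le> 0" using P by simp
      qed
    next
      case 2
      define T where "T = {i \<in> E. g (insert i A) = Suc (g A)}"
      have T: "T \<subseteq> E" and T': "\<And>i. i \<in> T \<Longrightarrow> i \<in> E \<and> g (insert i A) = Suc (g A)"
        by (auto simp: T_def)
      have K0: "?H None (Some i) = 0" if "i \<in> E" for i
        unfolding H0 using Q.rk_insert_le[OF A that] 2 by (auto simp: basis_def)
      have K: "?H (Some i) (Some l) = fact a * (of_bool (i \<in> T \<and> l \<in> T \<and> \<not> g (insert i (insert l A)) = Suc (g A))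
          + of_bool (i \<in> T \<and> l \<in> {}) + of_bool (i \<in> {} \<and> l \<in> T))" if il: "i \<in> E" "l \<in> E" for i l
      proof -
        have sym: "insert l (insert i A) = insert i (insert l A)" by auto
        have up: "g (insert i A) \<le> Suc (g A)" "g (insert l A) \<le> Suc (g A)"
          using Q.rk_insert_le[OF A] il by auto
        have lo: "g A \<le> g (insert i A)" "g A \<le> g (insert l A)"
          using Q.rk_insert_ge[OF A] il by auto
        have up2: "g (insert i (insert l A)) \<le> Suc (g (insert l A))"
            "g (insert i (insert l A)) \<le> Suc (g (insert i A))"
          using Q.rk_insert_le[of "insert l A" i] Q.rk_insert_le[of "insert i A" l] il A
          unfolding sym by auto
        have lo2: "g (insert l A) \<le> g (insert i (insert l A))"
          using Q.rk_insert_ge[of "insert l A" i] il A by auto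
        have "i \<notin> A \<and> l \<notin> A \<and> i \<noteq> l \<and> basis (insert i (insert l A)) \<longleftrightarrow>
            i \<in> T \<and> l \<in> T \<and> \<not> g (insert i (insert l A)) = Suc (g A)"
        proof
          assume "i \<notin> A \<and> l \<notin> A \<and> i \<noteq> l \<and> basis (insert i (insert l A))"
          then have "g (insert i (insert l A)) = g A + 2" using 2 by (simp add: basis_def)
          then show "i \<in> T \<and> l \<in> T \<and> \<not> g (insert i (insert l A)) = Suc (g A)"
            using up up2 il by (auto simp: T_def)
        next
          assume *: "i \<in> T \<and> l \<in> T \<and> \<not> g (insert i (insert l A)) = Suc (g A)"
          then have gil: "g (insert i A) = Suc (g A)" "g (insert l A) = Suc (g A)" by (auto simp: T_def)
          then have g2: "g (insert i (insert l A)) = Suc (g (insert l A))"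
            using * up2 lo2 by simp
          have "r (insert i (insert l A)) = Suc (r (insert l A))"
            using r_insert_of_g_insert[of "insert l A" i] g2 il A by auto
          moreover have "r (insert l A) = Suc (r A)"
            using r_insert_of_g_insert[of A l] gil il A by auto
          moreover have "i \<notin> A" "l \<notin> A" using outg gil by auto
          moreover have "i \<noteq> l" using g2 by auto
          ultimately show "i \<notin> A \<and> l \<notin> A \<and> i \<noteq> l \<and> basis (insert i (insert l A))"
            using g2 gil 2 il A rA finA by (simp add: basis_def)
        qed
        then show ?thesis unfolding H by simp
      qed
      show ?thesis
      proof (rule hyperbolic_if_nonpos_on_hyperplane[OF hessian_commute,
            where h = "\<lambda>x. case x of None \<Rightarrow> 0 | Some i \<Rightarrow> of_bool (i \<in> T)"])
        fix v :: "'a option \<Rightarrow> real"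
        define w where "w i = v (Some i)" for i
        define e where "e = (\<Sum>i\<in>T. w i)"
        define P where "P = (\<Sum>i\<in>T. \<Sum>l\<in>T. if g (insert i (insert l A)) = Suc (g A) then w i * w l else 0)"
        have sumT: "(\<Sum>i\<in>E. of_bool (i \<in> T) * w i) = e"
          unfolding e_def by (rule sum_of_bool_mult[OF fin T])
        assume "(\<Sum>x\<in>vars. (case x of None \<Rightarrow> 0 | Some i \<Rightarrow> of_bool (i \<in> T)) * v x) = 0"
        then have e: "e = 0"
          using fin by (simp add: sum.reindex sumT[symmetric] w_def)
        have P: "0 \<le> P"
          unfolding P_def using Q.parallel_form_bounds(1)[OF A T'] by blast
        have "bform vars ?H v v = - fact a * P"
        proof -
          have "(\<Sum>i\<in>E. ?H None (Some i) * v (Some i)) = 0"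
            by (intro sum.neutral ballI) (simp add: K0)
          moreover have "\<not> basis A" using 2 by (simp add: basis_def)
          moreover have "(\<Sum>i\<in>E. \<Sum>l\<in>E. ?H (Some i) (Some l) * v (Some i) * v (Some l)) = fact a * (e\<^sup>2 - P)"
            using sum_indicator_pattern[where w = w, OF fin T _ K] by (simp add: w_def e_def P_def)
          ultimately show ?thesis unfolding form H00 by (simp add: e)
        qed
        then show "bform vars ?H v v \<le> 0" using P by simp
      qed
    qed
  qed
qed

text \<open>
  A derivative of order \<open>k\<close> along a positive direction is positive at \<open>\<delta>\<close> iff \<open>\<delta>\<close> divides the monomial
  of some basis; the quotient of the two monomials then has degree \<open>k\<close>.
\<close>

lemma dirderiv_coeff_pos_iff:
  assumes u: "\<And>i. i \<in> vars \<Longrightarrow> 0 < u i"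
  shows "0 < (dirderiv vars u ^^ k) coeff \<delta> \<longleftrightarrow>
    size \<delta> + k = card E \<and> squarefree_part \<delta> \<and>
    (\<exists>S. basis S \<and> set_part \<delta> \<subseteq> S \<and> count \<delta> None + card S \<le> card E)"
proof -
  have "0 < (dirderiv vars u ^^ k) coeff \<delta> \<longleftrightarrow>
      (\<exists>\<gamma>. set_mset \<gamma> \<subseteq> vars \<and> size \<gamma> = k \<and> 0 < coeff (\<delta> + \<gamma>))"
    by (rule dirderiv_pos_iff[OF finite_vars coeff_nonneg u])
  also have "\<dots> \<longleftrightarrow> size \<delta> + k = card E \<and> squarefree_part \<delta> \<and>
    (\<exists>S. basis S \<and> set_part \<delta> \<subseteq> S \<and> count \<delta> None + card S \<le> card E)"
  proof (intro iffI)
    assume "\<exists>\<gamma>. set_mset \<gamma> \<subseteq> vars \<and> size \<gamma> = k \<and> 0 < coeff (\<delta> + \<gamma>)"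
    then obtain \<gamma> where \<gamma>: "size \<gamma> = k" "size (\<delta> + \<gamma>) = card E" "squarefree_part (\<delta> + \<gamma>)"
        "basis (set_part (\<delta> + \<gamma>))"
      by (auto simp: coeff_def split: if_splits)
    have "squarefree_part \<delta>"
      unfolding squarefree_part_def
    proof
      fix i
      show "count \<delta> (Some i) \<le> 1"
        using \<gamma>(3)[unfolded squarefree_part_def, rule_format, of i] by simp
    qed
    moreover have "set_part \<delta> \<subseteq> set_part (\<delta> + \<gamma>)"
      by (auto simp: set_part_def)
    moreover have "count \<delta> None + card (set_part (\<delta> + \<gamma>)) \<le> card E"
      using size_squarefree_part[OF \<gamma>(3)] \<gamma>(2) by simp
    ultimately show "size \<delta> + k = card E \<and> squarefree_part \<delta> \<and>
        (\<exists>S. basis S \<and> set_part \<delta> \<subseteq> S \<and> count \<delta> None + card S \<le> card E)"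
      using \<gamma> by auto
  next
    assume "size \<delta> + k = card E \<and> squarefree_part \<delta> \<and>
        (\<exists>S. basis S \<and> set_part \<delta> \<subseteq> S \<and> count \<delta> None + card S \<le> card E)"
    then obtain S where \<delta>: "size \<delta> + k = card E" "squarefree_part \<delta>"
      and S: "basis S" "set_part \<delta> \<subseteq> S" "count \<delta> None + card S \<le> card E" by blast
    \<comment> \<open>The monomial of \<open>S\<close>.\<close>
    define \<mu> where "\<mu> = replicate_mset (card E - card S) None + image_mset Some (mset_set S)"
    have finS: "finite S" using S(1) by (rule basis_finite)
    have count_Some: "count \<mu> (Some i) = (if i \<in> S then 1 else 0)" for i
      using finS by (simp add: \<mu>_def image_mset_mset_set inj_image_mem_iff)
    have count_None: "count \<mu> None = card E - card S"
      by (auto simp: \<mu>_def count_eq_zero_iff)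
    have "size \<mu> = card E" "squarefree_part \<mu>" "set_part \<mu> = S"
    proof -
      show "size \<mu> = card E"
        using S by (simp add: \<mu>_def)
      show "squarefree_part \<mu>"
        by (simp add: squarefree_part_def count_Some)
      have "i \<in> set_part \<mu> \<longleftrightarrow> i \<in> S" for i
      proof -
        have "i \<in> set_part \<mu> \<longleftrightarrow> 0 < count \<mu> (Some i)" by (simp add: set_part_def)
        then show ?thesis by (simp add: count_Some)
      qed
      then show "set_part \<mu> = S" by blast
    qed
    then have pos: "0 < coeff \<mu>" using S by (simp add: coeff_def)
    have "\<delta> \<subseteq># \<mu>"
    proof (rule mset_subset_eqI)
      fix x
      show "count \<delta> x \<le> count \<mu> x"
        using S \<delta>(2) by (cases x) (auto simp: count_None count_Some count_squarefree_part)
    qed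
    then obtain \<gamma> where \<gamma>: "\<mu> = \<delta> + \<gamma>"
      by (metis mset_subset_eq_exists_conv)
    have "set_mset \<mu> \<subseteq> vars"
      using S finS by (auto simp: \<mu>_def basis_def)
    then show "\<exists>\<gamma>. set_mset \<gamma> \<subseteq> vars \<and> size \<gamma> = k \<and> 0 < coeff (\<delta> + \<gamma>)"
      using \<gamma> \<open>size \<mu> = card E\<close> \<delta>(1) pos by (intro exI[of _ \<gamma>]) auto
  qed
  finally show ?thesis .
qed

text \<open>
  Call a basis \<open>S\<close> above \<open>A\<close> admissible if \<open>a + |S| \<le> n\<close>.  Two elements of \<open>S - A\<close> are joined whenever \<open>S\<close> is
  admissible, and each is joined to \<open>w\<^sub>0\<close> if the inequality is strict.  If some basis above \<open>A\<close> satisfies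
  the strict inequality, augmenting it from a given \<open>S\<close> connects the elements of \<open>S\<close> to \<open>w\<^sub>0\<close>.  Otherwise
  \<open>w\<^sub>0\<close> has a zero row and all admissible bases have the same, minimal, size, and an exchange connects any
  two of them.  The argument picks a second element of a basis outside \<open>A\<close>; there is one since the polynomial
  that has been differentiated \<open>|\<alpha>|\<close> times still has degree \<open>k + 3\<close>.
\<close>

lemma connected_support_hessian_dirderiv:
  assumes u: "\<And>i. i \<in> vars \<Longrightarrow> 0 < u i"
  shows "connected_support vars (hessian ((dirderiv vars u ^^ Suc k) coeff) \<alpha>)"
proof -
  define H where "H = hessian ((dirderiv vars u ^^ Suc k) coeff) \<alpha>"
  define A where "A = set_part \<alpha>"
  define a where "a = count \<alpha> None"
  have Hsym: "H x y = H y x" for x y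
    unfolding H_def by (rule hessian_commute)
  have size_Suc: "size (add_mset x (add_mset y \<alpha>)) + Suc k = size \<alpha> + k + 3" for x y
    by simp
  have pos_iff: "0 < (dirderiv vars u ^^ j) coeff \<delta> \<longleftrightarrow>
      size \<delta> + j = card E \<and> squarefree_part \<delta> \<and>
      (\<exists>S. basis S \<and> set_part \<delta> \<subseteq> S \<and> count \<delta> None + card S \<le> card E)" for j \<delta>
    by (rule dirderiv_coeff_pos_iff[OF u])
  have H: "0 < H x y \<longleftrightarrow> size \<alpha> + k + 3 = card E \<and> squarefree_part (add_mset x (add_mset y \<alpha>)) \<and>
      (\<exists>S. basis S \<and> set_part (add_mset x (add_mset y \<alpha>)) \<subseteq> S \<and>
        count (add_mset x (add_mset y \<alpha>)) None + card S \<le> card E)" for x y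
    unfolding H_def hessian_def pos_iff size_Suc by (rule refl)
  have "z x = z y"
    if z: "\<forall>x\<in>vars. \<forall>y\<in>vars. H x y > 0 \<longrightarrow> z x = z y"
      and vars: "x \<in> vars" "y \<in> vars" and x: "\<exists>a\<in>vars. H x a > 0" and y: "\<exists>b\<in>vars. H y b > 0"
    for z :: "'a option \<Rightarrow> real" and x y
  proof -
    from x obtain x' where x': "H x x' > 0" by blast
    have sf: "squarefree_part \<alpha>"
      using x'[unfolded H] by (cases x; cases x') auto
    have size: "size \<alpha> + k + 3 = card E"
      using x'[unfolded H] by blast
    have finA: "finite A" by (simp add: A_def)
    have n: "a + card A + k + 3 = card E"
      using size size_squarefree_part[OF sf] by (simp add: a_def A_def)
    have edge: "z (Some i) = z (Some l)"
      if "basis S" "A \<subseteq> S" "a + card S \<le> card E" "i \<in> S - A" "l \<in> S - A" for i l S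
    proof (cases "i = l")
      case False
      have "H (Some i) (Some l) > 0"
        unfolding H using that False sf size by (auto simp: A_def a_def intro!: exI[of _ S])
      moreover have "i \<in> E" "l \<in> E" using that by (auto simp: basis_def)
      ultimately show ?thesis using z by blast
    qed simp
    have edge0: "z (Some i) = z None"
      if "basis S" "A \<subseteq> S" "a + card S < card E" "i \<in> S - A" for i S
    proof -
      have "H (Some i) None > 0"
        unfolding H using that sf size by (auto simp: A_def a_def intro!: exI[of _ S])
      moreover have "i \<in> E" using that by (auto simp: basis_def)
      ultimately show ?thesis using z by blast
    qed
    have active: "\<exists>S. basis S \<and> A \<subseteq> S \<and> a + card S \<le> card E \<and> i \<in> S - A"
      if "\<exists>b\<in>vars. H (Some i) b > 0" for i
    proof -
      from that obtain b where "H (Some i) b > 0" by blast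
      then show ?thesis
        unfolding H by (cases b) (auto simp: A_def a_def)
    qed
    have active0: "\<exists>S. basis S \<and> A \<subseteq> S \<and> a + card S < card E"
      if "\<exists>b\<in>vars. H None b > 0"
    proof -
      from that obtain b where "H None b > 0" by blast
      then show ?thesis
        unfolding H by (cases b) (auto simp: A_def a_def intro: less_imp_le)
    qed
    show "z x = z y"
    proof (cases "\<exists>S. basis S \<and> A \<subseteq> S \<and> a + card S < card E")
      case True
      then obtain S0 where S0: "basis S0" "A \<subseteq> S0" "a + card S0 < card E" by blast
      have to_None: "z (Some i) = z None" if act: "\<exists>b\<in>vars. H (Some i) b > 0" for i
      proof -
        obtain S where S: "basis S" "A \<subseteq> S" "a + card S \<le> card E" "i \<in> S - A"
          using active[OF act] by blast
        show ?thesis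
        proof (cases "a + card S < card E")
          case True
          then show ?thesis using edge0 S by blast
        next
          case False
          then have card_S: "card S = card A + k + 3" using S n by simp
          have "card S0 \<le> card A + k + 2" "card A + k + 2 \<le> card S"
            using S0 n card_S by simp_all
          \<comment> \<open>The largest size that is still joined to \<open>w\<^sub>0\<close>; one more element of \<open>S\<close> keeps \<open>T\<close> admissible.\<close>
          then obtain T where T: "S0 \<subseteq> T" "basis T" "card T = card A + k + 2"
            using basis_extends[OF S0(1) S(1)] by blast
          have AT: "A \<subseteq> T" using S0 T by blast
          obtain e where e: "e \<in> S - T" "basis (insert e T)"
            using basis_augment[OF T(2) S(1)] T card_S by auto
          have "\<not> T \<subseteq> A"
            using T(3) card_mono[OF finA, of T] by linarith
          then obtain l where l: "l \<in> T - A" by blast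
          have "card (insert e T) = card A + k + 3"
            using e T basis_finite[OF T(2)] by simp
          then have "z (Some e) = z (Some l)"
            using edge[of "insert e T" e l] e l AT n by auto
          moreover have "z (Some l) = z None"
            using edge0[OF T(2) AT _ l] T n by simp
          moreover have "z (Some i) = z (Some e)"
            using edge[OF S(1-3), of i e] S e AT by blast
          ultimately show ?thesis by simp
        qed
      qed
      have "z w = z None" if "\<exists>b\<in>vars. H w b > 0" for w
      proof (cases w)
        case (Some i)
        then show ?thesis using that to_None by blast
      qed simp
      from this[OF x] this[OF y] show ?thesis by simp
    next
      case False
      then have "x \<noteq> None" "y \<noteq> None" using active0 x y by (metis (no_types, lifting))+
      then obtain i l where il: "x = Some i" "y = Some l" by auto
      obtain S where S: "basis S" "A \<subseteq> S" "a + card S \<le> card E" "i \<in> S - A"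
        using active[of i] x il by blast
      obtain T where T: "basis T" "A \<subseteq> T" "a + card T \<le> card E" "l \<in> T - A"
        using active[of l] y il by blast
      have min: "card T \<le> card U" if "basis U" "A \<subseteq> U" for U
      proof -
        have "\<not> a + card U < card E" using False that by blast
        then show ?thesis using T by linarith
      qed
      have "\<not> a + card T < card E" using False T by blast
      then have two: "card A + 2 \<le> card T" using n by linarith
      obtain U e where U: "basis U" "A \<subseteq> U" "card U = card T" "l \<in> U" "e \<in> U" "e \<in> S - A"
        using basis_chain_links[OF S(1) T(1) S(2) T(2) T(4) two min] by blast
      have "z (Some i) = z (Some e)"
        using edge[OF S(1-3)] S U by blast
      moreover have "z (Some e) = z (Some l)"
        using edge[OF U(1,2)] U T by auto
      ultimately show ?thesis using il by simp
    qed
  qed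
  then show ?thesis
    unfolding connected_support_def H_def[symmetric] by blast
qed

section \<open>Counting bases\<close>

text \<open>
  The perturbation of the direction \<open>\<Sum>\<^sub>i \<partial>\<^sub>i\<close> that makes it strictly positive.
\<close>

definition var_weight :: "real \<Rightarrow> 'a option \<Rightarrow> real" where
  "var_weight \<epsilon> x = (case x of None \<Rightarrow> \<epsilon> | Some i \<Rightarrow> 1)"

lemma dirderiv_var_weight_0: "dirderiv vars (var_weight 0) c \<beta> = (\<Sum>i\<in>E. c (add_mset (Some i) \<beta>))"
  using fin by (simp add: dirderiv_def var_weight_def sum.reindex)

lemma tendsto_dirderiv:
  "((\<lambda>\<epsilon>. (dirderiv vars (var_weight \<epsilon>) ^^ k) coeff \<beta>) \<longlongrightarrow> (dirderiv vars (var_weight 0) ^^ k) coeff \<beta>)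
    (at_right 0)"
proof (induction k arbitrary: \<beta>)
  case 0
  then show ?case by simp
next
  case (Suc k)
  have "((\<lambda>\<epsilon>. var_weight \<epsilon> x) \<longlongrightarrow> var_weight 0 x) (at_right 0)" for x
    by (cases x) (auto simp: var_weight_def)
  then show ?case
    unfolding dirderiv_Suc by (intro tendsto_sum tendsto_mult Suc.IH)
qed

lemma dirderiv_coeff_not_squarefree:
  "\<not> squarefree_part \<beta> \<Longrightarrow> (dirderiv vars u ^^ k) coeff \<beta> = 0"
proof (induction k arbitrary: \<beta>)
  case 0
  then show ?case by (simp add: coeff_def)
next
  case (Suc k)
  have "\<not> squarefree_part (add_mset x \<beta>)" for x
    using Suc.prems by (cases x) auto
  then show ?case using Suc.IH by (simp add: dirderiv_def)
qed

text \<open>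
  Each basis of the right size above the set part of \<open>\<beta>\<close> is reached by adding its \<open>k\<close> remaining elements
  in any order, which accounts for the factor \<open>k!\<close>.
\<close>

lemma dirderiv_coeff_eq:
  assumes "squarefree_part \<beta>" "set_part \<beta> \<subseteq> E" "size \<beta> + k = card E"
  shows "(dirderiv vars (var_weight 0) ^^ k) coeff \<beta> = fact (count \<beta> None) * fact k *
    real (card {S. basis S \<and> set_part \<beta> \<subseteq> S \<and> card S = card (set_part \<beta>) + k})"
  using assms
proof (induction k arbitrary: \<beta>)
  case 0
  have "S = set_part \<beta>" if "basis S" "set_part \<beta> \<subseteq> S" "card S = card (set_part \<beta>)" for S
    using card_subset_eq[OF basis_finite[OF that(1)] that(2)] that(3) by simp
  then have "{S. basis S \<and> set_part \<beta> \<subseteq> S \<and> card S = card (set_part \<beta>)} =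
      (if basis (set_part \<beta>) then {set_part \<beta>} else {})"
    by auto
  then show ?case using 0 by (simp add: coeff_def)
next
  case (Suc k)
  define A where "A = set_part \<beta>"
  define X where "X = {S. basis S \<and> A \<subseteq> S \<and> card S = card A + Suc k}"
  have A: "A \<subseteq> E" "finite A" using Suc.prems by (auto simp: A_def)
  have finX: "finite X"
    by (rule finite_subset[of _ "Pow E"]) (auto simp: X_def basis_def fin)
  have "(dirderiv vars (var_weight 0) ^^ Suc k) coeff \<beta> =
      (\<Sum>i\<in>E. (dirderiv vars (var_weight 0) ^^ k) coeff (add_mset (Some i) \<beta>))"
    by (simp add: dirderiv_var_weight_0)
  also have "\<dots> = (\<Sum>i\<in>E - A. (dirderiv vars (var_weight 0) ^^ k) coeff (add_mset (Some i) \<beta>))"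
    using fin by (intro sum.mono_neutral_right) (auto simp: A_def dirderiv_coeff_not_squarefree)
  also have "\<dots> = (\<Sum>i\<in>E - A. fact (count \<beta> None) * fact k * real (card {S \<in> X. i \<in> S}))"
  proof (rule sum.cong[OF refl])
    fix i assume i: "i \<in> E - A"
    have "{S. basis S \<and> insert i A \<subseteq> S \<and> card S = card (insert i A) + k} = {S \<in> X. i \<in> S}"
      using i A by (auto simp: X_def)
    then show "(dirderiv vars (var_weight 0) ^^ k) coeff (add_mset (Some i) \<beta>) =
        fact (count \<beta> None) * fact k * real (card {S \<in> X. i \<in> S})"
      using Suc.IH[of "add_mset (Some i) \<beta>"] Suc.prems i A by (simp add: A_def)
  qed
  also have "\<dots> = fact (count \<beta> None) * fact k * real (\<Sum>i\<in>E - A. card {S \<in> X. i \<in> S})"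
    by (simp add: sum_distrib_left)
  also have "(\<Sum>i\<in>E - A. card {S \<in> X. i \<in> S}) = Suc k * card X"
  proof (rule sum_multicount)
    show "\<forall>S\<in>X. card {i \<in> E - A. i \<in> S} = Suc k"
    proof
      fix S assume S: "S \<in> X"
      then have "{i \<in> E - A. i \<in> S} = S - A" by (auto simp: X_def basis_def)
      then show "card {i \<in> E - A. i \<in> S} = Suc k"
        using S A by (simp add: X_def card_Diff_subset)
    qed
  qed (use fin finX in auto)
  finally show ?case
    by (simp add: X_def A_def algebra_simps)
qed

lemma dirderiv_coeff_replicate_None:
  assumes "k \<le> card E"
  shows "(dirderiv vars (var_weight 0) ^^ k) coeff (replicate_mset (card E - k) None) =
    fact (card E - k) * fact k * real (card {S. basis S \<and> card S = k})"
proof -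
  have "set_part (replicate_mset m (None :: 'a option)) = {}" for m
    by (auto simp: set_part_def)
  moreover have "squarefree_part (replicate_mset m (None :: 'a option))" for m
    by (simp add: squarefree_part_def)
  ultimately show ?thesis
    using assms by (subst dirderiv_coeff_eq) auto
qed

text \<open>
  Reverse Cauchy-Schwarz for the vectors \<open>v\<close>, the direction of \<open>w\<^sub>0\<close>, and \<open>w\<close>, the sum of the other
  directions.  The three values of the form are derivatives along \<open>w\<^sub>0\<close> and \<open>w\<close> only, and hence counts of
  bases of sizes \<open>k - 1\<close>, \<open>k\<close> and \<open>k + 1\<close>.  The exact direction \<open>w\<close> is reached as the limit of positive
  ones.
\<close>

theorem ultra_log_concave_bases:
  assumes k: "0 < k" "k < card E"
  defines "b \<equiv> \<lambda>j. real (card {S. basis S \<and> card S = j})"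
  shows "(fact (card E - (k - 1)) * fact (k - 1) * b (k - 1)) * (fact (card E - (k + 1)) * fact (k + 1) * b (k + 1))
    \<le> (fact (card E - k) * fact k * b k)\<^sup>2"
proof -
  define n where "n = card E"
  define \<alpha> :: "'a option multiset" where "\<alpha> = replicate_mset (n - (k + 1)) None"
  define v :: "'a option \<Rightarrow> real" where "v x = (case x of None \<Rightarrow> 1 | Some i \<Rightarrow> 0)" for x
  define w :: "'a option \<Rightarrow> real" where "w x = (case x of None \<Rightarrow> 0 | Some i \<Rightarrow> 1)" for x
  define H where "H \<epsilon> = hessian ((dirderiv vars (var_weight \<epsilon>) ^^ (k - 1)) coeff) \<alpha>" for \<epsilon>
  have ineq: "bform vars (H \<epsilon>) v v * bform vars (H \<epsilon>) w w \<le> (bform vars (H \<epsilon>) v w)\<^sup>2" if "\<epsilon> > 0" for \<epsilon>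
  proof -
    have pos: "0 < var_weight \<epsilon> x" if "x \<in> vars" for x
      using \<open>\<epsilon> > 0\<close> by (auto simp: var_weight_def split: option.split)
    have "hyperbolic vars (H \<epsilon>)"
      unfolding H_def
      by (rule hyperbolic_hessian_dirderiv[OF finite_vars coeff_nonneg pos hyperbolic_hessian_coeff
            connected_support_hessian_dirderiv[OF pos]])
    moreover have "0 \<le> H \<epsilon> x y" for x y
      unfolding H_def hessian_def
      using pos by (intro dirderiv_nonneg coeff_nonneg) (auto intro: less_imp_le)
    then have "0 \<le> bform vars (H \<epsilon>) w w"
      unfolding bform_def by (intro sum_nonneg) (auto simp: w_def split: option.split)
    ultimately show ?thesis
      by (cases "bform vars (H \<epsilon>) w w = 0") (auto simp: hyperbolic_def)
  qed
  have lim: "((\<lambda>\<epsilon>. bform vars (H \<epsilon>) p q) \<longlongrightarrow> bform vars (H 0) p q) (at_right 0)" for p q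
    unfolding bform_def H_def hessian_def by (intro tendsto_sum tendsto_mult tendsto_const tendsto_dirderiv)
  have limit: "bform vars (H 0) v v * bform vars (H 0) w w \<le> (bform vars (H 0) v w)\<^sup>2"
  proof (rule tendsto_le[of "at_right (0::real)"])
    show "((\<lambda>\<epsilon>. bform vars (H \<epsilon>) v v * bform vars (H \<epsilon>) w w) \<longlongrightarrow> bform vars (H 0) v v * bform vars (H 0) w w) (at_right 0)"
      by (intro tendsto_mult lim)
    show "((\<lambda>\<epsilon>. (bform vars (H \<epsilon>) v w)\<^sup>2) \<longlongrightarrow> (bform vars (H 0) v w)\<^sup>2) (at_right 0)"
      by (intro tendsto_power lim)
    show "\<forall>\<^sub>F \<epsilon> in at_right 0. bform vars (H \<epsilon>) v v * bform vars (H \<epsilon>) w w \<le> (bform vars (H \<epsilon>) v w)\<^sup>2"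
      using eventually_at_right_less[of "0::real"] by eventually_elim (rule ineq)
  qed simp
  define D where "D j = (dirderiv vars (var_weight 0) ^^ j) coeff" for j
  have DS: "D (Suc j) \<beta> = (\<Sum>i\<in>E. D j (add_mset (Some i) \<beta>))" for j \<beta>
    by (simp add: D_def dirderiv_var_weight_0)
  have sum_vars: "(\<Sum>x\<in>vars. h x) = h None + (\<Sum>i\<in>E. h (Some i))" for h :: "'a option \<Rightarrow> real"
    using fin by (simp add: sum.reindex)
  have H0: "H 0 x y = D (k - 1) (add_mset x (add_mset y \<alpha>))" for x y
    by (simp add: H_def hessian_def D_def)
  have k': "Suc (k - 1) = k" "Suc k = k + 1" using k by auto
  have \<alpha>: "add_mset None \<alpha> = replicate_mset (n - k) None"
    "add_mset None (add_mset None \<alpha>) = replicate_mset (n - (k - 1)) None"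
  proof -
    have "n - k = Suc (n - (k + 1))" "n - (k - 1) = Suc (Suc (n - (k + 1)))"
      using k by (auto simp: n_def)
    then show "add_mset None \<alpha> = replicate_mset (n - k) None"
      "add_mset None (add_mset None \<alpha>) = replicate_mset (n - (k - 1)) None"
      by (simp_all add: \<alpha>_def)
  qed
  have vv: "bform vars (H 0) v v = D (k - 1) (replicate_mset (n - (k - 1)) None)"
    unfolding bform_def sum_vars by (simp add: v_def H0 \<alpha>(2))
  have "bform vars (H 0) v w = (\<Sum>i\<in>E. D (k - 1) (add_mset (Some i) (add_mset None \<alpha>)))"
    unfolding bform_def sum_vars by (simp add: v_def w_def H0 add_mset_commute)
  then have vw: "bform vars (H 0) v w = D k (replicate_mset (n - k) None)"
    unfolding DS[symmetric] k' \<alpha> .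
  have "bform vars (H 0) w w = (\<Sum>i\<in>E. \<Sum>l\<in>E. D (k - 1) (add_mset (Some l) (add_mset (Some i) \<alpha>)))"
    unfolding bform_def sum_vars by (simp add: w_def H0 add_mset_commute)
  then have ww: "bform vars (H 0) w w = D (k + 1) (replicate_mset (n - (k + 1)) None)"
    unfolding DS[symmetric] k' \<alpha>_def .
  have D: "D j (replicate_mset (n - j) None) = fact (n - j) * fact j * b j" if "j \<le> n" for j
    unfolding D_def n_def b_def using that by (intro dirderiv_coeff_replicate_None) (simp add: n_def)
  have le: "k - 1 \<le> n" "k + 1 \<le> n" "k \<le> n" using k by (auto simp: n_def)
  show ?thesis
    using limit unfolding vv vw ww D[OF le(1)] D[OF le(2)] D[OF le(3)] unfolding n_def .
qed

end

section \<open>Morphisms of matroids\<close>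

lemma (in matroid_morphism) quotient_of_morphism:
  "matroid_quotient E rkM (\<lambda>S. rkN (f ` S))"
proof
  show "finite E" by (rule M.finite_ground)
  show "rkN (f ` S) \<le> card S" if "S \<subseteq> E" for S
  proof -
    have "rkN (f ` S) \<le> card (f ` S)"
      using that maps_to by (intro N.rk_le_card) auto
    also have "\<dots> \<le> card S"
      using that M.finite_ground by (intro card_image_le) (rule finite_subset)
    finally show ?thesis .
  qed
  show "rkN (f ` S) \<le> rkN (f ` T)" if "S \<subseteq> T" "T \<subseteq> E" for S T
    using that maps_to by (intro N.rk_mono) auto
  show "rkN (f ` (S \<union> T)) + rkN (f ` (S \<inter> T)) \<le> rkN (f ` S) + rkN (f ` T)"
    if "S \<subseteq> E" "T \<subseteq> E" for S T
  proof -
    have "rkN (f ` (S \<inter> T)) \<le> rkN (f ` S \<inter> f ` T)"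
      using that maps_to by (intro N.rk_mono) auto
    moreover have "rkN (f ` S \<union> f ` T) + rkN (f ` S \<inter> f ` T) \<le> rkN (f ` S) + rkN (f ` T)"
      using that maps_to by (intro N.rk_submodular) auto
    ultimately show ?thesis by (simp add: image_Un)
  qed
  show "rkN (f ` T) + rkM S \<le> rkN (f ` S) + rkM T" if "S \<subseteq> T" "T \<subseteq> E" for S T
    using rk_diff_le[OF that] by linarith
qed

text \<open>
  Every independent set extends to a basis, and every spanning set contains one.
\<close>

lemma (in matroid_morphism) morphism_basis_iff:
  "morphism_basis E rkM F rkN f S \<longleftrightarrow> S \<subseteq> E \<and> rkM S = card S \<and> rkN (f ` S) = rkN F"
proof (intro iffI conjI)
  assume "morphism_basis E rkM F rkN f S"
  then obtain B C where S: "S \<subseteq> E" and B: "matroid_basis E rkM B" "S \<subseteq> B"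
    and C: "matroid_basis F rkN C" "C \<subseteq> f ` S"
    by (auto simp: morphism_basis_def)
  show "S \<subseteq> E" by (rule S)
  show "rkM S = card S"
    using B M.independent_subset[of S B] by (simp add: matroid_basis_def)
  have "f ` S \<subseteq> F" using S maps_to by auto
  then show "rkN (f ` S) = rkN F"
    using C N.rk_mono[of C "f ` S"] N.rk_mono[of "f ` S" F] by (simp add: matroid_basis_def)
next
  assume S: "S \<subseteq> E \<and> rkM S = card S \<and> rkN (f ` S) = rkN F"
  have fS: "f ` S \<subseteq> F" using S maps_to by auto
  obtain B where "S \<subseteq> B" "B \<subseteq> E" "rkM B = card B" "card B = rkM E"
    using M.independent_extends[of S E] S by auto
  moreover obtain C where "C \<subseteq> f ` S" "rkN C = card C" "card C = rkN F"
    using N.independent_extends[of "{}" "f ` S"] N.rk_le_card[of "{}"] S fS by auto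
  ultimately show "morphism_basis E rkM F rkN f S"
    using S fS unfolding morphism_basis_def matroid_basis_def by blast
qed

theorem theorem1p3:
  fixes E :: "'a set" and rkM :: "'a set \<Rightarrow> nat"
    and F :: "'b set" and rkN :: "'b set \<Rightarrow> nat"
    and f :: "'a \<Rightarrow> 'b" and n k :: nat
  assumes "matroid E rkM" and "matroid F rkN"
    and "matroid_morphism E rkM F rkN f"
    and "card E = n"
    and "0 < k" and "k < n"
  shows "(real (num_morphism_bases E rkM F rkN f k))\<^sup>2 / (real (n choose k))\<^sup>2
    \<ge> real (num_morphism_bases E rkM F rkN f (k - 1)) / real (n choose (k - 1))
      * (real (num_morphism_bases E rkM F rkN f (k + 1)) / real (n choose (k + 1)))"
proof -
  interpret matroid_morphism E rkM F rkN f by fact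
  interpret X: matroid_quotient E rkM "\<lambda>S. rkN (f ` S)"
    by (rule quotient_of_morphism)
  define b where "b j = real (num_morphism_bases E rkM F rkN f j)" for j
  have b_div: "b j / real (n choose j) = fact (n - j) * fact j * b j / fact n" if "j \<le> n" for j
    using that by (simp add: binomial_fact field_simps)
  have "(fact (n - (k - 1)) * fact (k - 1) * b (k - 1)) * (fact (n - (k + 1)) * fact (k + 1) * b (k + 1))
      \<le> (fact (n - k) * fact k * b k)\<^sup>2"
  proof (cases "rkN (f ` E) = rkN F")
    case True
    have "b j = real (card {S. X.basis S \<and> card S = j})" for j
      by (simp add: b_def num_morphism_bases_def morphism_basis_iff X.basis_def True)
    then show ?thesis
      using X.ultra_log_concave_bases[of k] assms by simp
  next
    case False
    have "rkN (f ` S) \<noteq> rkN F" if "S \<subseteq> E" for S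
    proof -
      have "rkN (f ` S) \<le> rkN (f ` E)" "rkN (f ` E) \<le> rkN F"
        using that maps_to by (auto intro!: N.rk_mono)
      then show ?thesis using False by linarith
    qed
    then have "b j = 0" for j
      by (auto simp: b_def num_morphism_bases_def morphism_basis_iff intro!: arg_cong[of _ "{}" card, simplified])
    then show ?thesis by simp
  qed
  then have "(fact (n - (k - 1)) * fact (k - 1) * b (k - 1)) * (fact (n - (k + 1)) * fact (k + 1) * b (k + 1)) / (fact n * fact n)
      \<le> (fact (n - k) * fact k * b k)\<^sup>2 / (fact n * fact n)"
    by (intro divide_right_mono) auto
  then have "b (k - 1) / real (n choose (k - 1)) * (b (k + 1) / real (n choose (k + 1)))
      \<le> (b k / real (n choose k))\<^sup>2"
    using assms(5,6) by (simp only: b_div) (simp add: b_div power2_eq_square)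
  then show ?thesis
    by (simp add: b_def power_divide)
qed

end
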